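(* Let $\mathcal A=\{1,\dots,d\}$. If $w\in\mathcal A^{\mathbb N}$ is an infinite, $C$-balanced word with totally irrational letter frequency vector $\mathbf r$, and if the weak limit $\mu(w)$ exists, then $$\mu_{\mathcal J}(w):=\sum_{\mathbf j\in\mathcal J}\mu(w)\circ t_{\mathbf j}^{-1}=D\,\mathrm{Leb},$$ where $D$ is the density of points in $\mathcal J$ and $\mathrm{Leb}$ denotes the Lebesgue measure on $\mathbb H$.
   Context: A sequence $w\in\mathcal A^{\mathbb N}$ is $C$-balanced if there is a constant $C\ge1$ such that $\bigl||w_{[j,j+n-1]}|_a-|w_{[k,k+n-1]}|_a\bigr|\le C$ for all $j,k,n\in\mathbb N$ and $a\in\mathcal A$, where $w_{[i,j]}=w_i\cdots w_j$ and $|u|_a$ is the number of occurrences of $a$ in $u$. Such a $w$ has a letter frequency vector $\mathbf r=(r_1,\dots,r_d)$, $r_i=\lim_{n\to\infty}\frac1n|w_{[1,n]}|_i$. Totally irrational means that $r_1,\dots,r_d$ are linearly independent over $\mathbb Q$. $\mathbb H\subset\mathbb R^d$ is a fixed $(d-1)$-dimensional linear hyperplane not containing $\mathbf r$, and $\pi$ is the linear projection along $\mathbf r$ onto $\mathbb H$. For a word $u$, $\psi(u)=(|u|_1,\dots,|u|_d)^T$. Set $\mu(w_{[1,n]})=\sum_{i=1}^n\delta_{\pi(\psi(w_{[1,i]}))}$ and $\mu(w)=\lim_{n\to\infty}n^{-1}\mu(w_{[1,n]})$ (weak limit), whenever it exists. $\mathcal J\subset\mathbb H$ is the lattice given by the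 integer span of $\pi(\mathbf e_i-\mathbf e_1)$, $2\le i\le d$, with $(\mathbf e_i)$ the standard basis of $\mathbb R^d$; its density $D$ is the reciprocal of the Lebesgue measure of a fundamental domain. For $\mathbf j\in\mathcal J$, $t_{\mathbf j}\colon\mathbb H\to\mathbb H$, $t_{\mathbf j}(\mathbf x)=\mathbf x+\mathbf j$. *)

theory Defs
  imports "HOL-Probability.Probability"
begin

section \<open>Infinite words\<close>

text \<open>
  The alphabet is a finite type \<open>'d\<close>, so \<open>d = CARD('d)\<close>. Infinite words are functions on
  \<open>nat\<close> indexed from 0: \<open>w i\<close> is the letter $w_{i+1}$.
\<close>

definition factor :: "(nat \<Rightarrow> 'd) \<Rightarrow> nat \<Rightarrow> nat \<Rightarrow> 'd list" where
  "factor w j n = map w [j..<j + n]"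

definition balanced :: "real \<Rightarrow> (nat \<Rightarrow> 'd) \<Rightarrow> bool" where
  "balanced C w \<longleftrightarrow> C \<ge> 1 \<and>
     (\<forall>j k n a. \<bar>real (count_list (factor w j n) a) - real (count_list (factor w k n) a)\<bar> \<le> C)"

definition letter_freq :: "(nat \<Rightarrow> 'd::finite) \<Rightarrow> real ^ 'd" where
  "letter_freq w = (\<chi> a. lim (\<lambda>n. real (count_list (factor w 0 n) a) / real n))"

text \<open>
  Linear independence over the rationals of the family of coordinates (not of the set of
  coordinates, so repeated coordinates are excluded).
\<close>

definition totally_irrational :: "real ^ 'd::finite \<Rightarrow> bool" where
  "totally_irrational r \<longleftrightarrow>
     (\<forall>q :: 'd \<Rightarrow> rat. (\<Sum>i\<in>UNIV. of_rat (q i) * r $ i) = 0 \<longrightarrow> (\<forall>i. q i = 0))"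

definition abelianization :: "'d list \<Rightarrow> real ^ 'd::finite" where
  "abelianization u = (\<chi> a. real (count_list u a))"

section \<open>The hyperplane, the projection and the lattice\<close>

definition proj_along :: "'a::real_vector \<Rightarrow> 'a set \<Rightarrow> 'a \<Rightarrow> 'a" where
  "proj_along r H x = (THE y. y \<in> H \<and> (\<exists>c. x = y + c *\<^sub>R r))"

text \<open>The letter \<open>i1\<close> plays the role of the letter 1.\<close>

definition proj_lattice :: "real ^ 'd::finite \<Rightarrow> (real ^ 'd) set \<Rightarrow> 'd \<Rightarrow> (real ^ 'd) set" where
  "proj_lattice r H i1 =
     {(\<Sum>i\<in>UNIV - {i1}. of_int (k i) *\<^sub>R proj_along r H (axis i 1 - axis i1 1)) | k :: 'd \<Rightarrow> int. True}"

section \<open>Measures on the hyperplane\<close>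

abbreviation borel_of :: "'a::topological_space set \<Rightarrow> 'a measure" where
  "borel_of H \<equiv> restrict_space borel H"

text \<open>
  Lebesgue measure (on Borel sets) on a linear subspace, with respect to the induced inner
  product: the image of product Lebesgue measure under the coordinate map of an orthonormal
  basis, as in the construction of \<^const>\<open>lborel\<close>. It does not depend on the chosen basis.
\<close>

definition subspace_lborel :: "'a::euclidean_space set \<Rightarrow> 'a measure" where
  "subspace_lborel H =
     (let B = (SOME B. B \<subseteq> H \<and> pairwise orthogonal B \<and> (\<forall>b\<in>B. norm b = 1) \<and> span B = H)
      in distr (\<Pi>\<^sub>M b\<in>B. lborel) (borel_of H) (\<lambda>f. \<Sum>b\<in>B. f b *\<^sub>R b))"

definition fundamental_domain :: "'a::euclidean_space set \<Rightarrow> 'a set \<Rightarrow> 'a set \<Rightarrow> bool" where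
  "fundamental_domain H J F \<longleftrightarrow> F \<in> sets (borel_of H) \<and> (\<forall>x\<in>H. \<exists>!j. j \<in> J \<and> x - j \<in> F)"

text \<open>All fundamental domains of a lattice have the same measure, so the choice is immaterial.\<close>

definition lattice_density :: "'a::euclidean_space set \<Rightarrow> 'a set \<Rightarrow> ennreal" where
  "lattice_density H J = 1 / emeasure (subspace_lborel H) (SOME F. fundamental_domain H J F)"

text \<open>
  The sum of a family of measures on the \<open>\<sigma>\<close>-algebra of \<open>M\<close>; only the measurable sets of
  \<open>M\<close> matter, not its values.
\<close>

definition sum_measure :: "'a measure \<Rightarrow> 'i set \<Rightarrow> ('i \<Rightarrow> 'a measure) \<Rightarrow> 'a measure" where
  "sum_measure M I N = measure_of (space M) (sets M) (\<lambda>A. \<Sum>\<^sub>\<infinity>i\<in>I. emeasure (N i) A)"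

definition prefix_measure ::
  "real ^ 'd::finite \<Rightarrow> (real ^ 'd) set \<Rightarrow> (nat \<Rightarrow> 'd) \<Rightarrow> nat \<Rightarrow> (real ^ 'd) measure" where
  "prefix_measure r H w n =
     sum_measure (borel_of H) {1..n}
       (\<lambda>i. return (borel_of H) (proj_along r H (abelianization (factor w 0 i))))"

definition weak_limit_on ::
  "'a::topological_space set \<Rightarrow> (nat \<Rightarrow> 'a measure) \<Rightarrow> 'a measure \<Rightarrow> bool" where
  "weak_limit_on H N M \<longleftrightarrow> sets M = sets (borel_of H) \<and> finite_measure M \<and>
     (\<forall>f :: 'a \<Rightarrow> real. continuous_on H f \<and> bounded (f ` H) \<longrightarrow>
        (\<lambda>n. \<integral>x. f x \<partial>N n) \<longlonglongrightarrow> (\<integral>x. f x \<partial>M))"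

end

theory Submission
  imports Defs
begin

text \<open>
  Modulo the lattice \<open>J\<close>, the projected prefixes of \<open>w\<close> form the orbit of a rotation. Indeed
  \<open>\<pi>(e\<^sub>b - e\<^sub>1)\<close> lies in \<open>J\<close> for every letter \<open>b\<close>, so that appending any letter
  moves the projected point by \<open>a = \<pi>(e\<^sub>1)\<close> up to an element of \<open>J\<close>
  (\<open>prefix_point_step\<close>). The theorem says that this orbit is equidistributed in the torus
  \<open>H / J\<close>, lifted back to \<open>H\<close>.

  Convenient coordinates on \<open>H\<close> come from the linear map \<open>c(x) = x - (\<Sum>\<^sub>i x\<^sub>i) r\<close>. Balance makes
  the letter frequencies exist, hence they sum to 1 and \<open>c\<close> kills \<open>r\<close>; so \<open>c\<close> does not see the
  projection \<open>\<pi>\<close>, it identifies \<open>H\<close> with the vectors of coordinate sum 0, and \<open>J\<close> with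
  the integer ones among them (\<open>proj_lattice_eq\<close>). The coordinates of \<open>a\<close> other than the first
  are \<open>-r\<^sub>2, \<dots>, -r\<^sub>d\<close>. As \<open>1 = \<Sum>\<^sub>i r\<^sub>i\<close>, total irrationality means that
  \<open>1, r\<^sub>2, \<dots>, r\<^sub>d\<close> are independent over the rationals, and Kronecker's theorem makes the
  multiples of \<open>a\<close> dense modulo \<open>J\<close> (\<open>dense_orbit\<close>).

  Let \<open>h\<close> be bounded, continuous and \<open>J\<close>-periodic. The averages of \<open>h\<close> and of
  \<open>h(\<sqdot> + a)\<close> over a prefix differ by a telescoping sum divided by its length, so in the limit
  \<open>\<mu>\<close> gives both functions the same integral (\<open>weak_limit_shift\<close>). By density and dominated
  convergence the same holds for every translation of \<open>H\<close>
  (\<open>translation_invariance_from_dense_multiples\<close>). Averaging over the translations in a fundamental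
  domain \<open>F\<close> and exchanging the integrals gives
  \<open>Leb(F) \<integral> h d\<mu> = \<integral>\<^sub>F h dLeb\<close> (\<open>nn_integral_average_over_fd\<close>). Periodic functions are functions on a
  torus, where finite Borel measures are determined by continuous functions, so the identity extends
  to all Borel periodic \<open>h \<ge> 0\<close> (\<open>nn_integral_eq_average_if_translation_invariant\<close>).

  Finally take \<open>h(x) = \<Sum>\<^sub>j 1\<^sub>A(x + j)\<close>, summing over \<open>J\<close>. Its \<open>\<mu>\<close>-integral is the periodized
  measure of \<open>A\<close>, and its integral over \<open>F\<close> is \<open>Leb(A)\<close>, because the translates of \<open>F\<close>
  tile \<open>H\<close>. Hence the periodized measure is \<open>Leb / Leb(F)\<close> (\<open>periodization_measure_eq\<close>).
\<close>

section \<open>Sums of measures and uniqueness of finite Borel measures\<close>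

text \<open>
  This turns unordered sums into integrals, for which Tonelli and monotone convergence are at hand.
\<close>

lemma nn_integral_count_space_eq_infsum:
  fixes f :: "'i \<Rightarrow> ennreal"
  assumes "countable I"
  shows "(\<integral>\<^sup>+i. f i \<partial>count_space I) = (\<Sum>\<^sub>\<infinity>i\<in>I. f i)"
proof (cases "finite I")
  case True
  then show ?thesis by (simp add: nn_integral_count_space_finite)
next
  case False
  define g where "g = from_nat_into I"
  have g: "bij_betw g UNIV I"
    unfolding g_def using assms False by (rule bij_betw_from_nat_into)
  have "(f \<circ> g) summable_on UNIV"
    by (rule nonneg_summable_on_complete) simp
  then have "(f \<circ> g) sums (\<Sum>\<^sub>\<infinity>n. (f \<circ> g) n)"
    by (intro has_sum_imp_sums has_sum_infsum)
  then have "(\<Sum>n. f (g n)) = (\<Sum>\<^sub>\<infinity>n. f (g n))"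
    by (simp add: sums_iff o_def)
  also have "\<dots> = (\<Sum>\<^sub>\<infinity>i\<in>I. f i)"
    by (rule infsum_reindex_bij_betw[OF g])
  finally show ?thesis
    using nn_integral_bij_count_space[OF g, of f] by (simp add: nn_integral_count_space_nat)
qed

text \<open>
  Since \<^const>\<open>measure_of\<close> is trivial on set functions that are not countably additive, the values of
  \<^const>\<open>sum_measure\<close> are only known once countable additivity is proved; here it is the exchange of
  a series with an integral over \<open>I\<close>.
\<close>

lemma
  assumes "countable I" and sets_N: "\<And>i. i \<in> I \<Longrightarrow> sets (N i) = sets M"
  shows sets_sum_measure: "sets (sum_measure M I N) = sets M"
    and emeasure_sum_measure:
      "A \<in> sets M \<Longrightarrow> emeasure (sum_measure M I N) A = (\<integral>\<^sup>+i. emeasure (N i) A \<partial>count_space I)"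
proof -
  show sets_eq: "sets (sum_measure M I N) = sets M"
    unfolding sum_measure_def by (simp add: sets.sigma_sets_eq sets.space_closed)
  have eq: "(\<Sum>\<^sub>\<infinity>i\<in>I. emeasure (N i) A) = (\<integral>\<^sup>+i. emeasure (N i) A \<partial>count_space I)" for A
    using assms(1) by (simp add: nn_integral_count_space_eq_infsum)
  assume A: "A \<in> sets M"
  show "emeasure (sum_measure M I N) A = (\<integral>\<^sup>+i. emeasure (N i) A \<partial>count_space I)"
  proof (rule emeasure_measure_of[where \<Omega>="space M" and A="sets M"])
    show "sum_measure M I N =
      measure_of (space M) (sets M) (\<lambda>A. \<integral>\<^sup>+i. emeasure (N i) A \<partial>count_space I)"
      unfolding sum_measure_def eq ..
    show "sets M \<subseteq> Pow (space M)" by (rule sets.space_closed)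
    show "positive (sets (sum_measure M I N)) (\<lambda>A. \<integral>\<^sup>+i. emeasure (N i) A \<partial>count_space I)"
      by (simp add: positive_def)
    show "A \<in> sets (sum_measure M I N)" using A sets_eq by simp
    show "countably_additive (sets (sum_measure M I N))
            (\<lambda>A. \<integral>\<^sup>+i. emeasure (N i) A \<partial>count_space I)"
    proof (rule countably_additiveI)
      fix X :: "nat \<Rightarrow> _" assume X: "range X \<subseteq> sets (sum_measure M I N)" "disjoint_family X"
      have "(\<Sum>n. \<integral>\<^sup>+i. emeasure (N i) (X n) \<partial>count_space I)
          = (\<integral>\<^sup>+i. (\<Sum>n. emeasure (N i) (X n)) \<partial>count_space I)"
        by (rule nn_integral_suminf[symmetric]) simp
      also have "\<dots> = (\<integral>\<^sup>+i. emeasure (N i) (\<Union>n. X n) \<partial>count_space I)"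
        using X sets_N sets_eq by (intro nn_integral_cong suminf_emeasure) auto
      finally show "(\<Sum>n. \<integral>\<^sup>+i. emeasure (N i) (X n) \<partial>count_space I)
          = (\<integral>\<^sup>+i. emeasure (N i) (\<Union>n. X n) \<partial>count_space I)" .
    qed
  qed
qed

text \<open>
  The indicator of a proper open set \<open>U\<close> is the limit of the continuous functions
  \<open>min 1 (k dist(x, -U))\<close>, so the measures agree on open sets, which form a generator
  closed under intersection.
\<close>

lemma finite_borel_measure_eqI_continuous:
  fixes M N :: "'a::metric_space measure"
  assumes "finite_measure M" "finite_measure N"
    and sets: "sets M = sets borel" "sets N = sets borel"
    and eq: "\<And>f :: 'a \<Rightarrow> real. continuous_on UNIV f \<Longrightarrow> (\<And>x. 0 \<le> f x \<and> f x \<le> 1) \<Longrightarrow>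
              (\<integral>x. f x \<partial>M) = (\<integral>x. f x \<partial>N)"
  shows "M = N"
proof -
  interpret M: finite_measure M by fact
  interpret N: finite_measure N by fact
  have [measurable_cong]: "sets M = sets borel" "sets N = sets borel" by (fact sets)+
  have open_eq: "emeasure M U = emeasure N U" if "open U" for U
  proof (cases "U = UNIV")
    case True
    have "(\<integral>x. (1::real) \<partial>M) = (\<integral>x. 1 \<partial>N)" by (rule eq) auto
    then have "measure M (space M) = measure N (space N)" by simp
    then show ?thesis
      using sets_eq_imp_space_eq[OF sets(1)] sets_eq_imp_space_eq[OF sets(2)] True
      by (simp add: M.emeasure_eq_measure N.emeasure_eq_measure)
  next
    case False
    define f where "f k x = min 1 (real k * infdist x (- U))" for k x
    have f_cont: "continuous_on UNIV (f k)" for k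
      unfolding f_def by (intro continuous_intros)
    have f_bd: "0 \<le> f k x \<and> f k x \<le> 1" for k x
      unfolding f_def by (simp add: infdist_nonneg)
    have f_lim: "(\<lambda>k. f k x) \<longlonglongrightarrow> indicator U x" for x
    proof (cases "x \<in> U")
      case True
      have "infdist x (- U) \<noteq> 0"
        using in_closed_iff_infdist_zero[of "- U" x] that False True by (auto simp: closed_Compl)
      then have pos: "infdist x (- U) > 0" using infdist_nonneg[of x "-U"] by linarith
      obtain K where K: "real K * infdist x (- U) \<ge> 1"
        using reals_Archimedean3[OF pos] by (metis less_imp_le)
      have "f k x = 1" if "k \<ge> K" for k
      proof -
        have "real K * infdist x (- U) \<le> real k * infdist x (- U)"
          using that pos by (intro mult_right_mono) auto
        then show ?thesis using K unfolding f_def by simp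
      qed
      then have "\<forall>\<^sub>F k in sequentially. f k x = 1"
        using eventually_sequentially by blast
      then show ?thesis using True by (simp add: tendsto_eventually)
    next
      case False
      then have "infdist x (- U) = 0" by (intro infdist_zero) simp
      then show ?thesis using False by (simp add: f_def)
    qed
    have f_meas [measurable]: "f k \<in> borel_measurable borel" for k
      by (rule borel_measurable_continuous_onI[OF f_cont])
    have [measurable]: "U \<in> sets borel" using that by simp
    have "(\<lambda>k. \<integral>x. f k x \<partial>M) \<longlonglongrightarrow> (\<integral>x. indicator U x \<partial>M)"
      by (rule integral_dominated_convergence[where w="\<lambda>_. 1"]) (use f_bd f_lim in auto)
    moreover have "(\<lambda>k. \<integral>x. f k x \<partial>N) \<longlonglongrightarrow> (\<integral>x. indicator U x \<partial>N)"
      by (rule integral_dominated_convergence[where w="\<lambda>_. 1"]) (use f_bd f_lim in auto)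
    moreover have "(\<integral>x. f k x \<partial>M) = (\<integral>x. f k x \<partial>N)" for k
      by (rule eq[OF f_cont f_bd])
    ultimately have "(\<integral>x. indicator U x \<partial>M) = (\<integral>x. indicator U x \<partial>N :: real)"
      using LIMSEQ_unique by simp
    then have "measure M U = measure N U"
      using sets_eq_imp_space_eq[OF sets(1)] sets_eq_imp_space_eq[OF sets(2)] by simp
    then show ?thesis
      by (simp add: M.emeasure_eq_measure N.emeasure_eq_measure)
  qed
  show ?thesis
  proof (rule measure_eqI_generator_eq[where E="{U. open U}" and \<Omega>=UNIV and A="\<lambda>_. UNIV"])
    show "Int_stable {U::'a set. open U}" by (auto simp: Int_stable_def)
    show "sets M = sigma_sets UNIV {U. open U}" "sets N = sigma_sets UNIV {U. open U}"
      using sets by (auto simp: borel_def)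
  qed (use open_eq in auto)
qed

text \<open>
  \<^const>\<open>Arg\<close> is continuous off the nonpositive real axis and takes only the values \<open>0\<close> and
  \<open>pi\<close> on it.
\<close>

lemma borel_measurable_Arg: "Arg \<in> borel_measurable borel"
proof -
  have eq: "Arg z = (if z \<in> \<real>\<^sub>\<le>\<^sub>0 then (if z = 0 then 0 else pi) else indicator (- \<real>\<^sub>\<le>\<^sub>0) z *\<^sub>R Arg z)" for z
    by (auto simp: Arg_zero Arg_eq_pi elim!: nonpos_Reals_cases simp: indicator_def)
  have "(\<lambda>z. indicator (- \<real>\<^sub>\<le>\<^sub>0) z *\<^sub>R Arg z) \<in> borel_measurable borel"
    by (rule borel_measurable_continuous_on_indicator) (auto intro: continuous_on_Arg)
  then show ?thesis
    by (subst eq[abs_def]) (intro measurable_If_set measurable_If, auto)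
qed

section \<open>Lebesgue measure on a linear subspace\<close>

lemma sets_subspace_lborel [simp, measurable_cong]: "sets (subspace_lborel H) = sets (borel_of H)"
  by (simp add: subspace_lborel_def Let_def)

lemma measurable_borel_of_iff:
  "(f \<in> measurable M (borel_of H)) \<longleftrightarrow> f \<in> borel_measurable M \<and> f \<in> space M \<rightarrow> H"
  by (auto simp: measurable_restrict_space2_iff)

text \<open>
  The definition of \<^const>\<open>subspace_lborel\<close> chooses some orthonormal basis; this gives access to one
  for which the measure is the image of product Lebesgue measure.
\<close>

lemma subspace_lborel_orthonormal:
  fixes H :: "'a::euclidean_space set"
  assumes "subspace H"
  obtains B where "finite B" "B \<subseteq> H" "span B = H"
    "\<And>b c. b \<in> B \<Longrightarrow> c \<in> B \<Longrightarrow> b \<bullet> c = (if b = c then 1 else 0)"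
    "subspace_lborel H = distr (\<Pi>\<^sub>M b\<in>B. lborel) (borel_of H) (\<lambda>f. \<Sum>b\<in>B. f b *\<^sub>R b)"
    "(\<lambda>f. \<Sum>b\<in>B. f b *\<^sub>R b) \<in> measurable (\<Pi>\<^sub>M b\<in>B. lborel) (borel_of H)"
proof -
  define Q where "Q B \<longleftrightarrow> B \<subseteq> H \<and> pairwise orthogonal B \<and> (\<forall>b\<in>B. norm b = 1) \<and> span B = H" for B
  define B where "B = (SOME B. Q B)"
  have "\<exists>B. Q B"
    unfolding Q_def using orthonormal_basis_subspace[OF assms] by metis
  then have "Q B" unfolding B_def by (rule someI_ex)
  then have B: "B \<subseteq> H" "pairwise orthogonal B" "\<And>b. b \<in> B \<Longrightarrow> norm b = 1" "span B = H"
    by (auto simp: Q_def)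
  show ?thesis
  proof
    have "independent B"
      using B(2,3) by (intro pairwise_orthogonal_independent) (auto dest: B(3)[of 0])
    then show "finite B" by (rule independent_imp_finite)
    show "B \<subseteq> H" "span B = H" by (fact B)+
    show "b \<bullet> c = (if b = c then 1 else 0)" if "b \<in> B" "c \<in> B" for b c
      using that B by (auto simp: pairwise_def orthogonal_def norm_eq_1)
    show "subspace_lborel H = distr (\<Pi>\<^sub>M b\<in>B. lborel) (borel_of H) (\<lambda>f. \<Sum>b\<in>B. f b *\<^sub>R b)"
      unfolding subspace_lborel_def B_def Q_def Let_def ..
    show "(\<lambda>f. \<Sum>b\<in>B. f b *\<^sub>R b) \<in> measurable (\<Pi>\<^sub>M b\<in>B. lborel) (borel_of H)"
      unfolding measurable_borel_of_iff
    proof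
      show "(\<lambda>f. \<Sum>b\<in>B. f b *\<^sub>R b) \<in> space (\<Pi>\<^sub>M b\<in>B. lborel) \<rightarrow> H"
        using B(1) assms by (auto intro!: subspace_sum subspace_scale)
    qed measurable
  qed
qed

locale subspace_translations =
  fixes H :: "'a::euclidean_space set"
  assumes subspace: "subspace H"
begin

abbreviation Leb :: "'a measure" where "Leb \<equiv> subspace_lborel H"

lemma H_borel [measurable, simp]: "H \<in> sets borel"
  using subspace by (intro borel_closed closed_subspace)

lemma H_ops: "x \<in> H \<Longrightarrow> y \<in> H \<Longrightarrow> x + y \<in> H" "x \<in> H \<Longrightarrow> y \<in> H \<Longrightarrow> x - y \<in> H"
  "x \<in> H \<Longrightarrow> - x \<in> H" "0 \<in> H" "x \<in> H \<Longrightarrow> c *\<^sub>R x \<in> H"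
  using subspace by (auto simp: subspace_add subspace_diff subspace_neg subspace_0 subspace_scale)

lemma space_H [simp]: "space (borel_of H) = H" "space Leb = H"
  using sets_eq_imp_space_eq[OF sets_subspace_lborel[of H]] by (simp_all add: space_restrict_space2)

lemma measurable_translation [measurable (raw)]:
  "t \<in> H \<Longrightarrow> (\<lambda>x. x + t) \<in> measurable (borel_of H) (borel_of H)"
  by (rule measurable_restrict_space3) (auto intro: H_ops)

text \<open>
  By the Cauchy--Schwarz inequality the orthonormal coordinates of a point of the ball lie in
  \<open>[-K, K]\<close>.
\<close>

lemma emeasure_Leb_cball: "emeasure Leb (H \<inter> cball 0 K) < \<infinity>"
proof -
  obtain B where B: "finite B" "B \<subseteq> H" "span B = H"
    "\<And>b c. b \<in> B \<Longrightarrow> c \<in> B \<Longrightarrow> b \<bullet> c = (if b = c then 1 else 0)"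
    and Leb: "Leb = distr (\<Pi>\<^sub>M b\<in>B. lborel) (borel_of H) (\<lambda>f. \<Sum>b\<in>B. f b *\<^sub>R b)"
    and meas: "(\<lambda>f. \<Sum>b\<in>B. f b *\<^sub>R b) \<in> measurable (\<Pi>\<^sub>M b\<in>B. lborel) (borel_of H)"
    using subspace_lborel_orthonormal[OF subspace] by blast
  interpret product_sigma_finite "\<lambda>_. lborel :: real measure" ..
  have "emeasure Leb (H \<inter> cball 0 K) =
      emeasure (\<Pi>\<^sub>M b\<in>B. lborel) ((\<lambda>f. \<Sum>b\<in>B. f b *\<^sub>R b) -` (H \<inter> cball 0 K) \<inter> space (\<Pi>\<^sub>M b\<in>B. lborel))"
    unfolding Leb by (rule emeasure_distr[OF meas]) (auto simp: sets_restrict_space_iff)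
  also have "\<dots> \<le> emeasure (\<Pi>\<^sub>M b\<in>B. lborel) (\<Pi>\<^sub>E b\<in>B. {-K..K})"
  proof (rule emeasure_mono)
    show "(\<Pi>\<^sub>E b\<in>B. {- K..K}) \<in> sets (\<Pi>\<^sub>M b\<in>B. lborel)"
      using B(1) by (intro sets_PiM_I_finite) auto
    show "(\<lambda>f. \<Sum>b\<in>B. f b *\<^sub>R b) -` (H \<inter> cball 0 K) \<inter> space (\<Pi>\<^sub>M b\<in>B. lborel) \<subseteq> (\<Pi>\<^sub>E b\<in>B. {- K..K})"
    proof
      fix f assume f: "f \<in> (\<lambda>f. \<Sum>b\<in>B. f b *\<^sub>R b) -` (H \<inter> cball 0 K) \<inter> space (\<Pi>\<^sub>M b\<in>B. lborel)"
      have "\<bar>f b\<bar> \<le> K" if "b \<in> B" for b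
      proof -
        have "(\<Sum>c\<in>B. f c *\<^sub>R c) \<bullet> b = (\<Sum>c\<in>B. if c = b then f c else 0)"
          unfolding inner_sum_left by (intro sum.cong refl) (simp add: B(4) that)
        then have "f b = (\<Sum>c\<in>B. f c *\<^sub>R c) \<bullet> b"
          using B(1) that by simp
        also have "\<bar>\<dots>\<bar> \<le> norm (\<Sum>c\<in>B. f c *\<^sub>R c) * norm b" by (rule Cauchy_Schwarz_ineq2)
        also have "norm b = 1" using B(4)[OF that that] by (simp add: norm_eq_1)
        also have "norm (\<Sum>c\<in>B. f c *\<^sub>R c) \<le> K" using f by simp
        finally show ?thesis by simp
      qed
      then show "f \<in> (\<Pi>\<^sub>E b\<in>B. {- K..K})"
        using f by (auto simp: space_PiM PiE_iff abs_le_iff minus_le_iff)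
    qed
  qed
  also have "\<dots> = (\<Prod>b\<in>B. emeasure lborel {-K..K})"
    using B(1) by (intro emeasure_PiM) auto
  also have "\<dots> < \<infinity>"
    by (auto simp: ennreal_prod_eq_top emeasure_lborel_Icc_eq top.not_eq_extremum[symmetric] prod_constant ennreal_power)
  finally show ?thesis .
qed

lemma Leb_nonzero: "emeasure Leb H \<noteq> 0"
proof -
  obtain B where B: "finite B" "B \<subseteq> H" "span B = H"
    "\<And>b c. b \<in> B \<Longrightarrow> c \<in> B \<Longrightarrow> b \<bullet> c = (if b = c then 1 else 0)"
    and Leb: "Leb = distr (\<Pi>\<^sub>M b\<in>B. lborel) (borel_of H) (\<lambda>f. \<Sum>b\<in>B. f b *\<^sub>R b)"
    and meas: "(\<lambda>f. \<Sum>b\<in>B. f b *\<^sub>R b) \<in> measurable (\<Pi>\<^sub>M b\<in>B. lborel) (borel_of H)"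
    using subspace_lborel_orthonormal[OF subspace] by blast
  interpret product_sigma_finite "\<lambda>_. lborel :: real measure" ..
  have "(\<lambda>f. \<Sum>b\<in>B. f b *\<^sub>R b) -` H \<inter> space (\<Pi>\<^sub>M b\<in>B. lborel) = space (\<Pi>\<^sub>M b\<in>B. lborel)"
    using measurable_space[OF meas] by auto
  then have "emeasure Leb H = emeasure (\<Pi>\<^sub>M b\<in>B. lborel :: real measure) (space (\<Pi>\<^sub>M b\<in>B. lborel))"
    unfolding Leb by (subst emeasure_distr[OF meas]) (auto simp: sets_restrict_space_iff)
  also have "\<dots> = (\<Prod>b\<in>B. emeasure lborel (UNIV :: real set))"
    unfolding space_PiM using emeasure_PiM[OF B(1), of "\<lambda>_. UNIV"] by simp
  finally show ?thesis by (simp add: prod_constant)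
qed

lemma sigma_finite_Leb: "sigma_finite_measure Leb"
proof (rule sigma_finite_measure.intro)
  let ?A = "range (\<lambda>n::nat. H \<inter> cball 0 (real n))"
  have "countable ?A" "?A \<subseteq> sets Leb" by (auto simp: sets_restrict_space_iff)
  moreover have "\<Union>?A = space Leb"
    using real_arch_simple by fastforce
  moreover have "\<forall>a\<in>?A. emeasure Leb a \<noteq> \<infinity>"
    using emeasure_Leb_cball by (auto simp: less_top)
  ultimately show "\<exists>A. countable A \<and> A \<subseteq> sets Leb \<and> \<Union> A = space Leb \<and> (\<forall>a\<in>A. emeasure Leb a \<noteq> \<infinity>)"
    by blast
qed

text \<open>
  Translation by \<open>t\<close> acts on orthonormal coordinates as a coordinatewise translation, which
  preserves product Lebesgue measure because it does so on boxes.
\<close>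

lemma Leb_translation:
  assumes t: "t \<in> H"
  shows "distr Leb (borel_of H) (\<lambda>x. x + t) = Leb"
proof -
  obtain B where B: "finite B" "B \<subseteq> H" "span B = H"
    "\<And>b c. b \<in> B \<Longrightarrow> c \<in> B \<Longrightarrow> b \<bullet> c = (if b = c then 1 else 0)"
    and Leb: "Leb = distr (\<Pi>\<^sub>M b\<in>B. lborel) (borel_of H) (\<lambda>f. \<Sum>b\<in>B. f b *\<^sub>R b)"
    and meas: "(\<lambda>f. \<Sum>b\<in>B. f b *\<^sub>R b) \<in> measurable (\<Pi>\<^sub>M b\<in>B. lborel) (borel_of H)"
    using subspace_lborel_orthonormal[OF subspace] by blast
  interpret product_sigma_finite "\<lambda>_. lborel :: real measure" ..
  let ?S = "\<lambda>f. \<Sum>b\<in>B. f b *\<^sub>R b"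
  let ?PI = "\<Pi>\<^sub>M b\<in>B. lborel :: real measure"
  have "t \<in> span B" using t B(3) by simp
  then obtain c where c: "t = (\<Sum>b\<in>B. c b *\<^sub>R b)"
    using span_finite[OF B(1)] by auto
  define T where "T f = (\<lambda>b\<in>B. f b + c b)" for f
  have T_meas: "T \<in> measurable ?PI ?PI"
    unfolding T_def by measurable
  have T_inv: "distr ?PI ?PI T = ?PI"
  proof (rule PiM_eqI[OF B(1)])
    fix A assume A: "\<And>b. b \<in> B \<Longrightarrow> A b \<in> sets (lborel :: real measure)"
    have pre: "(\<lambda>x. x + c b) -` A b \<in> sets borel" if "b \<in> B" for b
      using A[OF that] measurable_sets[of "\<lambda>x. x + c b" borel borel "A b"] by simp
    have "emeasure (distr ?PI ?PI T) (Pi\<^sub>E B A) = emeasure ?PI (T -` Pi\<^sub>E B A \<inter> space ?PI)"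
      using A B(1) by (intro emeasure_distr[OF T_meas] sets_PiM_I_finite) auto
    also have "T -` Pi\<^sub>E B A \<inter> space ?PI = (\<Pi>\<^sub>E b\<in>B. (\<lambda>x. x + c b) -` A b)"
      by (auto simp: T_def space_PiM PiE_iff)
    also have "emeasure ?PI \<dots> = (\<Prod>b\<in>B. emeasure lborel ((\<lambda>x. x + c b) -` A b))"
      by (rule emeasure_PiM) (use B(1) pre in auto)
    also have "\<dots> = (\<Prod>b\<in>B. emeasure lborel (A b))"
    proof (intro prod.cong refl)
      fix b assume b: "b \<in> B"
      have "emeasure lborel (A b) = emeasure (distr lborel borel ((+) (c b))) (A b)"
        by (simp add: lborel_distr_plus)
      also have "\<dots> = emeasure lborel ((\<lambda>x. x + c b) -` A b)"
        using A[OF b] by (subst emeasure_distr) (auto simp: add.commute intro!: arg_cong[where f="emeasure lborel"])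
      finally show "emeasure lborel ((\<lambda>x. x + c b) -` A b) = emeasure lborel (A b)" ..
    qed
    finally show "emeasure (distr ?PI ?PI T) (Pi\<^sub>E B A) = (\<Prod>b\<in>B. emeasure lborel (A b))" .
  qed simp
  have "distr Leb (borel_of H) (\<lambda>x. x + t) = distr ?PI (borel_of H) (\<lambda>f. ?S f + t)"
    unfolding Leb using distr_distr[OF measurable_translation[OF t] meas] by (simp add: o_def)
  also have "\<dots> = distr ?PI (borel_of H) (\<lambda>f. ?S (T f))"
    by (intro distr_cong) (auto simp: c T_def sum.distrib algebra_simps)
  also have "\<dots> = distr (distr ?PI ?PI T) (borel_of H) ?S"
    using distr_distr[OF meas T_meas] by (simp add: o_def)
  finally show ?thesis unfolding T_inv Leb .
qed

lemma nn_integral_Leb_translation: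
  assumes "t \<in> H" "g \<in> borel_measurable (borel_of H)"
  shows "(\<integral>\<^sup>+x. g (x + t) \<partial>Leb) = (\<integral>\<^sup>+x. g x \<partial>Leb)"
proof -
  have "(\<integral>\<^sup>+x. g x \<partial>Leb) = (\<integral>\<^sup>+x. g x \<partial>distr Leb (borel_of H) (\<lambda>x. x + t))"
    using Leb_translation[OF assms(1)] by simp
  also have "\<dots> = (\<integral>\<^sup>+x. g (x + t) \<partial>Leb)"
    using assms by (intro nn_integral_distr) simp_all
  finally show ?thesis ..
qed

end

section \<open>Periodic functions and fundamental domains of a lattice\<close>

text \<open>
  Countability of \<open>L\<close> is what lets sums over \<open>L\<close> be exchanged with integrals.
\<close>

locale translation_lattice = subspace_translations H for H :: "'a::euclidean_space set" +
  fixes L :: "'a set"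
  assumes lattice_subset: "L \<subseteq> H" and lattice_diff: "\<And>x y. x \<in> L \<Longrightarrow> y \<in> L \<Longrightarrow> x - y \<in> L"
    and lattice_zero: "0 \<in> L" and countable_lattice: "countable L"
begin

abbreviation fd :: "'a set \<Rightarrow> bool" where "fd \<equiv> fundamental_domain H L"

definition periodic :: "('a \<Rightarrow> 'b) \<Rightarrow> bool" where
  "periodic g \<longleftrightarrow> (\<forall>x\<in>H. \<forall>j\<in>L. g (x + j) = g x)"

lemma periodicD: "periodic g \<Longrightarrow> x \<in> H \<Longrightarrow> j \<in> L \<Longrightarrow> g (x + j) = g x"
  by (simp add: periodic_def)

lemma lattice_in_H: "j \<in> L \<Longrightarrow> j \<in> H" using lattice_subset by auto

lemma lattice_uminus: "j \<in> L \<Longrightarrow> - j \<in> L" using lattice_diff[OF lattice_zero] by simp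

lemma lattice_add: "i \<in> L \<Longrightarrow> j \<in> L \<Longrightarrow> i + j \<in> L"
  using lattice_diff[of i "- j"] lattice_uminus[of j] by simp

lemma bij_lattice_uminus: "bij_betw uminus L L"
  by (rule bij_betwI[where g=uminus]) (auto intro: lattice_uminus)

lemma bij_lattice_add: "j \<in> L \<Longrightarrow> bij_betw (\<lambda>i. j + i) L L"
  by (rule bij_betwI[where g="\<lambda>i. i - j"]) (auto intro: lattice_diff lattice_add)

lemma fd_sets: "fd F \<Longrightarrow> F \<in> sets (borel_of H)"
  and fd_sum: "fd F \<Longrightarrow> x \<in> H \<Longrightarrow> (\<integral>\<^sup>+j. indicator F (x - j) \<partial>count_space L) = 1"
proof -
  assume F: "fd F"
  show "F \<in> sets (borel_of H)" using F by (simp add: fundamental_domain_def)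
  assume x: "x \<in> H"
  obtain i where i: "i \<in> L" "x - i \<in> F" "\<And>j. j \<in> L \<Longrightarrow> x - j \<in> F \<Longrightarrow> j = i"
    using F x unfolding fundamental_domain_def by metis
  have "x - j \<in> F \<longleftrightarrow> j = i" if "j \<in> L" for j
    using i(2) i(3)[OF that] by blast
  then have "(\<integral>\<^sup>+j. indicator F (x - j) \<partial>count_space L) = (\<integral>\<^sup>+j. indicator {i} j \<partial>count_space L)"
    by (intro nn_integral_cong) (simp add: indicator_def)
  also have "\<dots> = 1" using i(1) by simp
  finally show "(\<integral>\<^sup>+j. indicator F (x - j) \<partial>count_space L) = 1" .
qed

lemma fd_sum_plus: "fd F \<Longrightarrow> x \<in> H \<Longrightarrow> (\<integral>\<^sup>+j. indicator F (x + j) \<partial>count_space L) = 1"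
  using nn_integral_bij_count_space[OF bij_lattice_uminus, of "\<lambda>j. indicator F (x - j)"] fd_sum[of F x]
  by simp

definition periodize :: "('a \<Rightarrow> ennreal) \<Rightarrow> 'a \<Rightarrow> ennreal" where
  "periodize h x = (\<integral>\<^sup>+j. h (x + j) \<partial>count_space L)"

lemma measurable_periodize [measurable (raw)]:
  assumes h: "h \<in> borel_measurable (borel_of H)"
  shows "periodize h \<in> borel_measurable (borel_of H)"
proof -
  have [measurable]: "(\<lambda>x. h (x + j)) \<in> borel_measurable (borel_of H)" if "j \<in> L" for j
    by (rule measurable_compose[OF measurable_translation[OF lattice_in_H[OF that]] h])
  show ?thesis
    unfolding periodize_def
  proof (rule sigma_finite_measure.borel_measurable_nn_integral)
    show "sigma_finite_measure (count_space L)"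
      using countable_lattice by (rule sigma_finite_measure_count_space_countable)
    show "(\<lambda>(x, j). h (x + j)) \<in> borel_measurable (borel_of H \<Otimes>\<^sub>M count_space L)"
    proof -
      have "(\<lambda>p. h (fst p + j)) \<in> borel_measurable (borel_of H \<Otimes>\<^sub>M count_space L)" if "j \<in> L" for j
        by (rule measurable_compose[OF measurable_fst])
          (rule measurable_compose[OF measurable_translation[OF lattice_in_H[OF that]] h])
      then show ?thesis
        unfolding case_prod_beta
        using measurable_compose_countable'[where f="\<lambda>j p. h (fst p + j)" and g=snd and I=L]
          countable_lattice measurable_snd by blast
    qed
  qed
qed

lemma periodic_periodize: "periodic (periodize h)"
proof -
  have "periodize h (x + j) = periodize h x" if "j \<in> L" for x j
    unfolding periodize_def
    using nn_integral_bij_count_space[OF bij_lattice_add[OF that], of "\<lambda>i. h (x + i)"]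
    by (simp add: add.assoc)
  then show ?thesis by (simp add: periodic_def)
qed

text \<open>
  The translates of \<open>F\<close> by \<open>L\<close> tile \<open>H\<close>. Moving the sum out of the integral and
  translating each term by its \<open>j\<close> replaces \<open>F\<close> by the union of these tiles.
\<close>

lemma unfolding_formula:
  assumes F: "fd F" and h: "h \<in> borel_measurable (borel_of H)"
  shows "(\<integral>\<^sup>+x. indicator F x * periodize h x \<partial>Leb) = (\<integral>\<^sup>+x. h x \<partial>Leb)"
proof -
  have [measurable]: "F \<in> sets (borel_of H)" by (rule fd_sets[OF F])
  note h [measurable]
  have [measurable]: "(\<lambda>x. h (x + j)) \<in> borel_measurable (borel_of H)"
    "(\<lambda>x. indicator F (x - j) :: ennreal) \<in> borel_measurable (borel_of H)" if "j \<in> L" for j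
    using measurable_compose[OF measurable_translation[OF lattice_in_H[OF that]] h]
      measurable_compose[OF measurable_translation[OF lattice_in_H[OF lattice_uminus[OF that]]],
        of "indicator F :: _ \<Rightarrow> ennreal"] by simp_all
  have "(\<integral>\<^sup>+x. indicator F x * periodize h x \<partial>Leb)
      = (\<integral>\<^sup>+x. \<integral>\<^sup>+j. indicator F x * h (x + j) \<partial>count_space L \<partial>Leb)"
    unfolding periodize_def by (simp add: nn_integral_cmult)
  also have "\<dots> = (\<integral>\<^sup>+j. \<integral>\<^sup>+x. indicator F x * h (x + j) \<partial>Leb \<partial>count_space L)"
    by (rule nn_integral_count_space_nn_integral[OF countable_lattice]) measurable
  also have "\<dots> = (\<integral>\<^sup>+j. \<integral>\<^sup>+x. indicator F (x - j) * h x \<partial>Leb \<partial>count_space L)"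
  proof (rule nn_integral_cong)
    fix j assume "j \<in> space (count_space L)"
    then have j: "j \<in> L" by simp
    show "(\<integral>\<^sup>+x. indicator F x * h (x + j) \<partial>Leb) = (\<integral>\<^sup>+x. indicator F (x - j) * h x \<partial>Leb)"
      using j by (subst nn_integral_Leb_translation[OF lattice_in_H[OF j], symmetric]) simp_all
  qed
  also have "\<dots> = (\<integral>\<^sup>+x. \<integral>\<^sup>+j. indicator F (x - j) * h x \<partial>count_space L \<partial>Leb)"
    by (rule nn_integral_count_space_nn_integral[OF countable_lattice, symmetric]) measurable
  also have "\<dots> = (\<integral>\<^sup>+x. h x \<partial>Leb)"
    using fd_sum[OF F] by (intro nn_integral_cong) (simp add: nn_integral_multc)
  finally show ?thesis .
qed

text \<open>
  A periodic \<open>g\<close> is itself a periodization, namely that of \<open>g\<close> restricted to \<open>F'\<close>; unfolding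
  it over \<open>F\<close> leaves the integral over \<open>F'\<close>.
\<close>

lemma nn_integral_fd_eq:
  assumes F: "fd F" and F': "fd F'" and g: "g \<in> borel_measurable (borel_of H)" "periodic g"
  shows "(\<integral>\<^sup>+x. indicator F x * g x \<partial>Leb) = (\<integral>\<^sup>+x. indicator F' x * g x \<partial>Leb)"
proof -
  note [measurable] = fd_sets[OF F'] g(1)
  have "periodize (\<lambda>x. indicator F' x * g x) x = g x" if "x \<in> H" for x
  proof -
    have "periodize (\<lambda>x. indicator F' x * g x) x = (\<integral>\<^sup>+j. indicator F' (x + j) * g x \<partial>count_space L)"
      unfolding periodize_def using periodicD[OF g(2) that] by (intro nn_integral_cong) simp
    then show ?thesis using fd_sum_plus[OF F' that] by (simp add: nn_integral_multc)
  qed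
  then have "(\<integral>\<^sup>+x. indicator F x * g x \<partial>Leb)
      = (\<integral>\<^sup>+x. indicator F x * periodize (\<lambda>x. indicator F' x * g x) x \<partial>Leb)"
    by (intro nn_integral_cong) simp
  also have "\<dots> = (\<integral>\<^sup>+x. indicator F' x * g x \<partial>Leb)"
    by (rule unfolding_formula[OF F]) measurable
  finally show ?thesis .
qed

lemma fd_translate:
  assumes F: "fd F" and t: "t \<in> H"
  shows "fd {x \<in> H. x - t \<in> F}"
proof -
  note [measurable] = fd_sets[OF F]
  have "(\<lambda>x. x + (- t)) -` F \<inter> space (borel_of H) \<in> sets (borel_of H)"
    by (intro measurable_sets[OF measurable_translation]) (use t in \<open>auto intro: H_ops\<close>)
  also have "(\<lambda>x. x + (- t)) -` F \<inter> space (borel_of H) = {x \<in> H. x - t \<in> F}" by auto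
  finally have "{x \<in> H. x - t \<in> F} \<in> sets (borel_of H)" .
  moreover have "\<exists>!j. j \<in> L \<and> x - j \<in> {x \<in> H. x - t \<in> F}" if "x \<in> H" for x
  proof -
    have "j \<in> L \<and> x - j \<in> {x \<in> H. x - t \<in> F} \<longleftrightarrow> j \<in> L \<and> (x - t) - j \<in> F" for j
      using that by (auto simp: H_ops lattice_in_H algebra_simps)
    moreover have "\<exists>!j. j \<in> L \<and> (x - t) - j \<in> F"
      using F H_ops(2)[OF that t] by (simp add: fundamental_domain_def)
    ultimately show ?thesis by simp
  qed
  ultimately show ?thesis by (simp add: fundamental_domain_def)
qed

text \<open>
  Integrating the invariance identity over \<open>t \<in> F\<close> and exchanging the integrals leaves, for each
  \<open>x\<close>, the Lebesgue integral of \<open>g\<close> over \<open>x + F\<close>. As \<open>x + F\<close> is again a fundamental domain,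
  that integral does not depend on \<open>x\<close>, and \<open>\<mu>\<close> has total mass 1.
\<close>

lemma nn_integral_average_over_fd:
  assumes \<mu>: "prob_space \<mu>" and sets_\<mu>: "sets \<mu> = sets (borel_of H)"
    and F: "fd F" and g: "g \<in> borel_measurable (borel_of H)" "periodic g"
    and inv: "\<And>t. t \<in> H \<Longrightarrow> (\<integral>\<^sup>+x. g (x + t) \<partial>\<mu>) = (\<integral>\<^sup>+x. g x \<partial>\<mu>)"
  shows "emeasure Leb F * (\<integral>\<^sup>+x. g x \<partial>\<mu>) = (\<integral>\<^sup>+x. indicator F x * g x \<partial>Leb)"
proof -
  interpret \<mu>: prob_space \<mu> by fact
  interpret Leb: sigma_finite_measure Leb by (rule sigma_finite_Leb)
  interpret pair_sigma_finite \<mu> Leb ..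
  note [measurable_cong] = sets_\<mu>
  note [measurable] = fd_sets[OF F] g(1)
  have space_\<mu> [simp]: "space \<mu> = H" using sets_eq_imp_space_eq[OF sets_\<mu>] by simp
  have [measurable]: "(\<lambda>p. fst p + snd p) \<in> measurable (\<mu> \<Otimes>\<^sub>M Leb) (borel_of H)"
    unfolding measurable_borel_of_iff
  proof
    have "(\<lambda>x. x) \<in> measurable (borel_of H) borel" by (rule measurable_restrict_space1) simp
    then have [measurable]: "(\<lambda>x. x) \<in> measurable \<mu> borel" "(\<lambda>x. x) \<in> measurable Leb borel"
      by (simp_all cong: measurable_cong_sets add: sets_\<mu>)
    show "(\<lambda>p. fst p + snd p) \<in> borel_measurable (\<mu> \<Otimes>\<^sub>M Leb)"
      using measurable_compose[OF measurable_fst \<open>(\<lambda>x. x) \<in> measurable \<mu> borel\<close>]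
        measurable_compose[OF measurable_snd \<open>(\<lambda>x. x) \<in> measurable Leb borel\<close>]
      by (intro borel_measurable_add) auto
    show "(\<lambda>p. fst p + snd p) \<in> space (\<mu> \<Otimes>\<^sub>M Leb) \<rightarrow> H"
      by (auto simp: space_pair_measure H_ops)
  qed
  have [measurable]: "(\<lambda>(x, t). indicator F t * g (x + t)) \<in> borel_measurable (\<mu> \<Otimes>\<^sub>M Leb)"
    using measurable_compose[OF \<open>(\<lambda>p. fst p + snd p) \<in> measurable (\<mu> \<Otimes>\<^sub>M Leb) (borel_of H)\<close> g(1)]
    unfolding case_prod_beta by measurable
  have "emeasure Leb F * (\<integral>\<^sup>+x. g x \<partial>\<mu>) = (\<integral>\<^sup>+t. indicator F t * (\<integral>\<^sup>+x. g x \<partial>\<mu>) \<partial>Leb)"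
    by (simp add: nn_integral_multc)
  also have "\<dots> = (\<integral>\<^sup>+t. indicator F t * (\<integral>\<^sup>+x. g (x + t) \<partial>\<mu>) \<partial>Leb)"
    by (intro nn_integral_cong) (simp add: inv)
  also have "\<dots> = (\<integral>\<^sup>+t. \<integral>\<^sup>+x. indicator F t * g (x + t) \<partial>\<mu> \<partial>Leb)"
  proof (rule nn_integral_cong)
    fix t assume "t \<in> space Leb"
    then have "(\<lambda>x. g (x + t)) \<in> borel_measurable \<mu>"
      using measurable_compose[OF measurable_translation g(1), of t]
      by (simp cong: measurable_cong_sets add: sets_\<mu>)
    then show "indicator F t * (\<integral>\<^sup>+x. g (x + t) \<partial>\<mu>) = (\<integral>\<^sup>+x. indicator F t * g (x + t) \<partial>\<mu>)"
      by (simp add: nn_integral_cmult)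
  qed
  also have "\<dots> = (\<integral>\<^sup>+x. \<integral>\<^sup>+t. indicator F t * g (x + t) \<partial>Leb \<partial>\<mu>)"
    by (rule Fubini') measurable
  also have "\<dots> = (\<integral>\<^sup>+x. (\<integral>\<^sup>+t. indicator F t * g t \<partial>Leb) \<partial>\<mu>)"
  proof (rule nn_integral_cong)
    fix x assume "x \<in> space \<mu>"
    then have x: "x \<in> H" by simp
    note [measurable] = fd_sets[OF fd_translate[OF F x]]
    have "(\<integral>\<^sup>+t. indicator F t * g (x + t) \<partial>Leb)
        = (\<integral>\<^sup>+t. indicator {y \<in> H. y - x \<in> F} (t + x) * g (t + x) \<partial>Leb)"
      using x by (intro nn_integral_cong) (auto simp: indicator_def H_ops add.commute)
    also have "\<dots> = (\<integral>\<^sup>+t. indicator {y \<in> H. y - x \<in> F} t * g t \<partial>Leb)"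
      by (rule nn_integral_Leb_translation[OF x]) measurable
    also have "\<dots> = (\<integral>\<^sup>+t. indicator F t * g t \<partial>Leb)"
      by (rule nn_integral_fd_eq[OF fd_translate[OF F x] F g])
    finally show "(\<integral>\<^sup>+t. indicator F t * g (x + t) \<partial>Leb) = (\<integral>\<^sup>+t. indicator F t * g t \<partial>Leb)" .
  qed
  also have "\<dots> = (\<integral>\<^sup>+t. indicator F t * g t \<partial>Leb)"
    using \<mu>.emeasure_space_1 by simp
  finally show ?thesis .
qed

text \<open>
  Countably many translates of a null fundamental domain could not cover \<open>H\<close>: unfolding the
  constant 1 over \<open>F\<close> gives the measure of \<open>H\<close>.
\<close>

lemma emeasure_fd_nonzero:
  assumes F: "fd F"
  shows "emeasure Leb F \<noteq> 0"
proof
  assume "emeasure Leb F = 0"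
  note [measurable] = fd_sets[OF F]
  have "AE x in Leb. x \<notin> F"
    using \<open>emeasure Leb F = 0\<close> by (intro AE_not_in) (auto simp: null_sets_def)
  then have "(\<integral>\<^sup>+x. indicator F x * periodize (\<lambda>_. 1) x \<partial>Leb) = (\<integral>\<^sup>+x. 0 \<partial>Leb)"
    by (intro nn_integral_cong_AE) (auto elim!: eventually_mono)
  then have "emeasure Leb H = 0"
    using unfolding_formula[OF F, of "\<lambda>_. 1"] by simp
  then show False using Leb_nonzero by simp
qed

text \<open>
  An arbitrary fundamental domain may be unbounded, but it has the measure of any bounded one.
\<close>

lemma emeasure_fd_finite:
  assumes F: "fd F" and F': "fd F'" "bounded F'"
  shows "emeasure Leb F < \<infinity>"
proof -
  note [measurable] = fd_sets[OF F] fd_sets[OF F'(1)]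
  have "F' \<subseteq> H" using sets.sets_into_space[OF fd_sets[OF F'(1)]] by simp
  obtain K where "\<forall>x\<in>F'. norm x \<le> K" using F'(2) unfolding bounded_iff by blast
  then have K: "F' \<subseteq> cball 0 K" by auto
  have "emeasure Leb F = emeasure Leb F'"
  proof -
    have one: "(\<lambda>_. 1 :: ennreal) \<in> borel_measurable (borel_of H)" "periodic (\<lambda>_. 1 :: ennreal)"
      by (simp_all add: periodic_def)
    have "emeasure Leb F = (\<integral>\<^sup>+x. indicator F x * 1 \<partial>Leb)"
      using fd_sets[OF F] by simp
    also have "\<dots> = (\<integral>\<^sup>+x. indicator F' x * 1 \<partial>Leb)"
      by (rule nn_integral_fd_eq[OF F F'(1) one])
    also have "\<dots> = emeasure Leb F'"
      using fd_sets[OF F'(1)] by simp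
    finally show ?thesis .
  qed
  also have "\<dots> \<le> emeasure Leb (H \<inter> cball 0 K)"
    using K \<open>F' \<subseteq> H\<close> by (intro emeasure_mono) (auto simp: sets_restrict_space_iff)
  also have "\<dots> < \<infinity>" by (rule emeasure_Leb_cball)
  finally show ?thesis .
qed

text \<open>
  The identity \<open>haar\<close> is applied to the periodization of the indicator of a set \<open>A\<close>: its
  \<open>\<mu>\<close>-integral is the left-hand side at \<open>A\<close>, and by unfolding its integral over \<open>F\<close> is the Lebesgue
  measure of \<open>A\<close>.
\<close>

lemma periodization_measure_eq:
  assumes sets_\<mu>: "sets \<mu> = sets (borel_of H)"
    and F: "fd F" "emeasure Leb F < \<infinity>"
    and haar: "\<And>g. g \<in> borel_measurable (borel_of H) \<Longrightarrow> periodic g \<Longrightarrow>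
       emeasure Leb F * (\<integral>\<^sup>+x. g x \<partial>\<mu>) = (\<integral>\<^sup>+x. indicator F x * g x \<partial>Leb)"
  shows "sum_measure (borel_of H) L (\<lambda>j. distr \<mu> (borel_of H) (\<lambda>x. x + j)) =
         scale_measure (1 / emeasure Leb F) Leb"
    (is "?M = ?N")
proof (rule measure_eqI)
  note [measurable_cong] = sets_\<mu>
  have space_\<mu> [simp]: "space \<mu> = H" using sets_eq_imp_space_eq[OF sets_\<mu>] by simp
  have sets_M: "sets ?M = sets (borel_of H)"
    by (rule sets_sum_measure[OF countable_lattice]) simp
  then show "sets ?M = sets ?N" by simp
  fix A assume "A \<in> sets ?M"
  then have A [measurable]: "A \<in> sets (borel_of H)" by (simp add: sets_M)
  have trans_\<mu>: "(\<lambda>x. x + j) \<in> measurable \<mu> (borel_of H)" if "j \<in> L" for j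
    using measurable_translation[OF lattice_in_H[OF that]] by (simp cong: measurable_cong_sets add: sets_\<mu>)
  have "emeasure ?M A = (\<integral>\<^sup>+j. emeasure (distr \<mu> (borel_of H) (\<lambda>x. x + j)) A \<partial>count_space L)"
    by (rule emeasure_sum_measure[OF countable_lattice]) (simp_all add: A)
  also have "\<dots> = (\<integral>\<^sup>+j. \<integral>\<^sup>+x. indicator A (x + j) \<partial>\<mu> \<partial>count_space L)"
  proof (rule nn_integral_cong)
    fix j assume "j \<in> space (count_space L)"
    then have j: "j \<in> L" by simp
    have "emeasure (distr \<mu> (borel_of H) (\<lambda>x. x + j)) A
        = (\<integral>\<^sup>+x. indicator A x \<partial>distr \<mu> (borel_of H) (\<lambda>x. x + j))"
      by (simp add: A)
    also have "\<dots> = (\<integral>\<^sup>+x. indicator A (x + j) \<partial>\<mu>)"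
      by (rule nn_integral_distr[OF trans_\<mu>[OF j]]) (simp add: A)
    finally show "emeasure (distr \<mu> (borel_of H) (\<lambda>x. x + j)) A = (\<integral>\<^sup>+x. indicator A (x + j) \<partial>\<mu>)" .
  qed
  also have "\<dots> = (\<integral>\<^sup>+x. periodize (indicator A) x \<partial>\<mu>)"
    unfolding periodize_def
    using measurable_compose[OF trans_\<mu>, of _ "indicator A :: _ \<Rightarrow> ennreal"] A
    by (intro nn_integral_count_space_nn_integral[OF countable_lattice, symmetric]) simp
  finally have M: "emeasure ?M A = (\<integral>\<^sup>+x. periodize (indicator A) x \<partial>\<mu>)" .
  have "emeasure Leb F * emeasure ?M A = (\<integral>\<^sup>+x. indicator F x * periodize (indicator A) x \<partial>Leb)"
    unfolding M by (rule haar[OF _ periodic_periodize]) measurable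
  also have "\<dots> = emeasure Leb A"
    using unfolding_formula[OF F(1), of "indicator A"] A by simp
  finally have "emeasure Leb F * emeasure ?M A = emeasure Leb A" .
  then have "emeasure ?M A = emeasure Leb A / emeasure Leb F"
    using emeasure_fd_nonzero[OF F(1)] F(2)
    by (metis ennreal_mult_divide_eq infinity_ennreal_def less_irrefl mult.commute)
  then show "emeasure ?M A = emeasure ?N A"
    by (simp add: ennreal_divide_times)
qed

text \<open>
  Invariance under \<open>a\<close> iterates to all integer multiples of \<open>a\<close> because \<open>base\<close> may be applied to
  translates of \<open>h\<close>, and elements of \<open>L\<close> do not change a periodic function. Every \<open>t\<close> is a limit
  of translations of this kind, and the integrals converge by dominated convergence.
\<close>

lemma translation_invariance_from_dense_multiples:
  fixes h :: "'a \<Rightarrow> real"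
  assumes \<mu>: "prob_space \<mu>" and sets_\<mu>: "sets \<mu> = sets (borel_of H)" and a: "a \<in> H"
    and base: "\<And>h :: 'a \<Rightarrow> real. continuous_on H h \<Longrightarrow> bounded (h ` H) \<Longrightarrow> periodic h \<Longrightarrow>
      (\<integral>x. h (x + a) \<partial>\<mu>) = (\<integral>x. h x \<partial>\<mu>)"
    and dense: "\<And>t e. t \<in> H \<Longrightarrow> e > 0 \<Longrightarrow> \<exists>(k::int) j. j \<in> L \<and> dist (of_int k *\<^sub>R a + j) t < e"
    and h: "continuous_on H h" "bounded (h ` H)" "periodic h" and t: "t \<in> H"
  shows "(\<integral>x. h (x + t) \<partial>\<mu>) = (\<integral>x. h x \<partial>\<mu>)"
proof -
  interpret \<mu>: prob_space \<mu> by fact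
  note [measurable_cong] = sets_\<mu>
  have space_\<mu> [simp]: "space \<mu> = H" using sets_eq_imp_space_eq[OF sets_\<mu>] by simp
  have sa: "c *\<^sub>R a \<in> H" for c using a subspace by (simp add: subspace_scale)
  have shift: "continuous_on H (\<lambda>x. h (x + s))" "bounded ((\<lambda>x. h (x + s)) ` H)" "periodic (\<lambda>x. h (x + s))"
    if h: "continuous_on H h" "bounded (h ` H)" "periodic h" and s: "s \<in> H" for h :: "'a \<Rightarrow> real" and s
  proof -
    show "continuous_on H (\<lambda>x. h (x + s))"
      by (rule continuous_on_compose2[OF h(1)]) (auto intro!: continuous_intros H_ops s)
    show "bounded ((\<lambda>x. h (x + s)) ` H)"
      by (rule bounded_subset[OF h(2)]) (auto intro: H_ops s)
    have "h (x + j + s) = h (x + s)" if "x \<in> H" "j \<in> L" for x j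
      using periodicD[OF h(3) H_ops(1)[OF that(1) s] that(2)] by (simp add: ac_simps)
    then show "periodic (\<lambda>x. h (x + s))" by (simp add: periodic_def)
  qed
  have nat_mult: "(\<integral>x. h (x + real n *\<^sub>R a) \<partial>\<mu>) = (\<integral>x. h x \<partial>\<mu>)"
    if h: "continuous_on H h" "bounded (h ` H)" "periodic h" for h :: "'a \<Rightarrow> real" and n
  proof (induction n)
    case (Suc n)
    have "(\<integral>x. h (x + real (Suc n) *\<^sub>R a) \<partial>\<mu>) = (\<integral>x. h (x + a + real n *\<^sub>R a) \<partial>\<mu>)"
      by (simp add: algebra_simps)
    also have "\<dots> = (\<integral>x. h (x + real n *\<^sub>R a) \<partial>\<mu>)"
      by (rule base[OF shift[OF h sa]])
    finally show ?case using Suc by simp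
  qed simp
  have int_mult: "(\<integral>x. h (x + of_int k *\<^sub>R a) \<partial>\<mu>) = (\<integral>x. h x \<partial>\<mu>)" for k
  proof (cases "k \<ge> 0")
    case True
    then show ?thesis using nat_mult[OF h, of "nat k"] by simp
  next
    case False
    \<comment> \<open>For negative \<open>k\<close>, the nonnegative multiple \<open>-k\<close> acts on the translate of \<open>h\<close> by \<open>k a\<close>.\<close>
    have "(\<integral>x. h (x + real (nat (- k)) *\<^sub>R a + of_int k *\<^sub>R a) \<partial>\<mu>) = (\<integral>x. h (x + of_int k *\<^sub>R a) \<partial>\<mu>)"
      by (rule nat_mult[OF shift[OF h sa]])
    moreover have "x + real (nat (- k)) *\<^sub>R a + of_int k *\<^sub>R a = x" for x
      using False by simp
    ultimately show ?thesis by simp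
  qed
  have "\<exists>s. s \<in> H \<and> dist s t < inverse (real (Suc n)) \<and> (\<integral>x. h (x + s) \<partial>\<mu>) = (\<integral>x. h x \<partial>\<mu>)" for n
  proof -
    obtain k :: int and j where j: "j \<in> L" "dist (of_int k *\<^sub>R a + j) t < inverse (real (Suc n))"
      using dense[OF t, of "inverse (real (Suc n))"] by auto
    have "(\<integral>x. h (x + (of_int k *\<^sub>R a + j)) \<partial>\<mu>) = (\<integral>x. h (x + of_int k *\<^sub>R a) \<partial>\<mu>)"
    proof (rule Bochner_Integration.integral_cong[OF refl])
      fix x assume "x \<in> space \<mu>"
      then show "h (x + (of_int k *\<^sub>R a + j)) = h (x + of_int k *\<^sub>R a)"
        using periodicD[OF h(3) H_ops(1)[OF _ sa] j(1), of x] by (simp add: add.assoc)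
    qed
    then show ?thesis
      using j int_mult[of k] sa lattice_in_H[OF j(1)]
      by (intro exI[of _ "of_int k *\<^sub>R a + j"]) (auto intro: H_ops)
  qed
  then obtain s where s: "\<And>n. s n \<in> H" "\<And>n. dist (s n) t < inverse (real (Suc n))"
    "\<And>n. (\<integral>x. h (x + s n) \<partial>\<mu>) = (\<integral>x. h x \<partial>\<mu>)" by metis
  have s_lim: "s \<longlonglongrightarrow> t"
    by (rule metric_tendsto_imp_tendsto[OF LIMSEQ_inverse_real_of_nat])
      (use s(2) in \<open>auto simp: less_imp_le\<close>)
  obtain B where B: "\<And>x. x \<in> H \<Longrightarrow> \<bar>h x\<bar> \<le> B"
    using h(2) unfolding bounded_iff by auto
  have meas: "(\<lambda>x. h (x + u)) \<in> borel_measurable \<mu>" if "u \<in> H" for u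
  proof -
    have "(\<lambda>x. h (x + u)) \<in> borel_measurable (borel_of H)"
      by (rule borel_measurable_continuous_on_restrict[OF shift(1)[OF h that]])
    then show ?thesis by (simp cong: measurable_cong_sets add: sets_\<mu>)
  qed
  have "(\<lambda>n. \<integral>x. h (x + s n) \<partial>\<mu>) \<longlonglongrightarrow> (\<integral>x. h (x + t) \<partial>\<mu>)"
  proof (rule integral_dominated_convergence[where w="\<lambda>_. B"])
    show "AE x in \<mu>. (\<lambda>n. h (x + s n)) \<longlonglongrightarrow> h (x + t)"
    proof (rule AE_I2)
      fix x assume "x \<in> space \<mu>"
      then have x: "x \<in> H" by simp
      show "(\<lambda>n. h (x + s n)) \<longlonglongrightarrow> h (x + t)"
        by (rule continuous_on_tendsto_compose[OF h(1)])
          (auto intro!: tendsto_intros always_eventually s_lim H_ops x t s(1))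
    qed
    show "AE x in \<mu>. norm (h (x + s n)) \<le> B" for n
      using B s(1) by (intro AE_I2) (auto intro: H_ops)
  qed (use meas t s(1) in auto)
  then have "(\<lambda>n. \<integral>x. h x \<partial>\<mu>) \<longlonglongrightarrow> (\<integral>x. h (x + t) \<partial>\<mu>)" by (simp add: s(3))
  then show ?thesis using LIMSEQ_unique tendsto_const by blast
qed

end

section \<open>The projection, its coordinates and its lattice\<close>

text \<open>
  The plane \<open>H\<close> and the direction \<open>r\<close> of the projection. The condition \<open>sum_r\<close> normalizes
  \<open>r\<close> so that the functional summing the coordinates takes the value 1 on it.
\<close>

locale oblique_projection = subspace_translations H for H :: "(real ^ 'd::finite) set" +
  fixes r :: "real ^ 'd"
  assumes dim_H: "dim H = CARD('d) - 1" and r_notin_H: "r \<notin> H"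
    and sum_r: "(\<Sum>i\<in>UNIV. r $ i) = 1"
begin

abbreviation P :: "real ^ 'd \<Rightarrow> real ^ 'd" where "P \<equiv> proj_along r H"

text \<open>
  This is the projection along \<open>r\<close> onto the hyperplane of vectors of coordinate sum 0. Restricted to
  \<open>H\<close> it is a linear isomorphism with inverse \<open>P\<close>, which serves as a coordinate system in which
  the lattice has integer points.
\<close>

definition coord :: "real ^ 'd \<Rightarrow> real ^ 'd" where
  "coord x = x - (\<Sum>i\<in>UNIV. x $ i) *\<^sub>R r"

text \<open>
  The lattice in a form that treats all letters alike; \<open>proj_lattice_eq\<close> identifies it with
  \<^const>\<open>proj_lattice\<close>.
\<close>

definition L :: "(real ^ 'd) set" where
  "L = {x \<in> H. \<forall>i. coord x $ i \<in> \<int>}"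

lemma decomposition: "\<exists>!y. y \<in> H \<and> (\<exists>c. x = y + c *\<^sub>R r)"
proof (rule ex_ex1I)
  have "r \<notin> span H" using r_notin_H subspace by (metis span_eq_iff)
  then have "dim (insert r H) = DIM(real ^ 'd)"
    using dim_H by (simp add: dim_insert)
  then have "span (insert r H) = UNIV" using dim_eq_full by blast
  then have "x \<in> span (insert r H)" by simp
  then obtain c where "x - c *\<^sub>R r \<in> span H"
    unfolding span_breakdown_eq by blast
  then show "\<exists>y. y \<in> H \<and> (\<exists>c. x = y + c *\<^sub>R r)"
    using subspace by (intro exI[of _ "x - c *\<^sub>R r"]) (auto simp: span_eq_iff[THEN iffD2])
next
  fix y z
  assume "y \<in> H \<and> (\<exists>c. x = y + c *\<^sub>R r)" "z \<in> H \<and> (\<exists>c. x = z + c *\<^sub>R r)"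
  then obtain c d where yz: "y \<in> H" "z \<in> H" "y + c *\<^sub>R r = z + d *\<^sub>R r" by metis
  then have eq: "y - z = (d - c) *\<^sub>R r" by (simp add: algebra_simps)
  have "y - z \<in> H" using yz subspace by (simp add: subspace_diff)
  have "d = c"
  proof (rule ccontr)
    assume "d \<noteq> c"
    then have "r = (1 / (d - c)) *\<^sub>R (y - z)" using eq by simp
    then have "r \<in> H" using \<open>y - z \<in> H\<close> subspace by (metis subspace_scale)
    then show False using r_notin_H by simp
  qed
  then show "y = z" using eq by simp
qed

lemma P_in_H: "P x \<in> H" and P_decomposes: "\<exists>c. x = P x + c *\<^sub>R r"
  unfolding proj_along_def using theI'[OF decomposition[of x]] by blast+

lemma P_eqI: "y \<in> H \<Longrightarrow> x = y + c *\<^sub>R r \<Longrightarrow> P x = y"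
  unfolding proj_along_def using the1_equality[OF decomposition[of x]] by blast

lemma linear_P: "linear P"
proof (rule linearI)
  fix x y
  obtain c d where cd: "x = P x + c *\<^sub>R r" "y = P y + d *\<^sub>R r" using P_decomposes by metis
  have "x + y = (P x + P y) + (c + d) *\<^sub>R r"
    by (subst cd(1), subst cd(2)) (simp add: algebra_simps)
  then show "P (x + y) = P x + P y"
    using subspace by (intro P_eqI) (auto intro: subspace_add P_in_H)
next
  fix a x
  obtain c where c: "x = P x + c *\<^sub>R r" using P_decomposes by metis
  have "a *\<^sub>R x = a *\<^sub>R P x + (a * c) *\<^sub>R r"
    by (subst c) (simp add: algebra_simps)
  then show "P (a *\<^sub>R x) = a *\<^sub>R P x"
    using subspace by (intro P_eqI) (auto intro: subspace_scale P_in_H)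
qed

lemma linear_coord: "linear coord"
  by (rule linearI)
    (simp_all add: coord_def sum.distrib algebra_simps flip: sum_distrib_left)

lemma continuous_coord: "continuous_on S (\<lambda>x. coord x $ i)"
  using linear_coord by (intro continuous_on_component linear_continuous_on) (simp add: linear_conv_bounded_linear)

lemma coord_r: "coord r = 0"
  by (simp add: coord_def sum_r)

lemma coord_P: "coord (P x) = coord x"
proof -
  obtain c where c: "x = P x + c *\<^sub>R r" using P_decomposes by metis
  have "coord x = coord (P x) + c *\<^sub>R coord r"
    by (subst c) (simp add: linear_add[OF linear_coord] linear_scale[OF linear_coord])
  then show ?thesis by (simp add: coord_r)
qed

lemma P_coord: "x \<in> H \<Longrightarrow> P (coord x) = x"
  by (rule P_eqI[where c="- (\<Sum>i\<in>UNIV. x $ i)"]) (simp_all add: coord_def)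

lemma sum_coord: "(\<Sum>i\<in>UNIV. coord x $ i) = 0"
  by (simp add: coord_def sum_subtractf sum_r flip: sum_distrib_left)

lemma coord_sum_zero: "(\<Sum>i\<in>UNIV. y $ i) = 0 \<Longrightarrow> coord y = y"
  by (simp add: coord_def)

lemma coord_nth_eq: "coord x $ i1 = - (\<Sum>i\<in>UNIV-{i1}. coord x $ i)"
  using sum_coord[of x] by (simp add: sum.remove[of UNIV i1])

lemma coord_add: "coord (x + y) = coord x + coord y"
  and coord_diff: "coord (x - y) = coord x - coord y"
  and coord_scale: "coord (c *\<^sub>R x) = c *\<^sub>R coord x"
  using linear_coord by (auto simp: linear_add linear_diff linear_scale)

lemma L_subset: "x \<in> L \<Longrightarrow> x \<in> H" by (simp add: L_def)

lemma L_diff: "x \<in> L \<Longrightarrow> y \<in> L \<Longrightarrow> x - y \<in> L"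
  by (auto simp: L_def coord_diff H_ops)

text \<open>
  The coordinates sum to 0, so one of them may be left unchecked.
\<close>

lemma L_if_other_coords_int:
  assumes "x \<in> H" "\<And>i. i \<noteq> i1 \<Longrightarrow> coord x $ i \<in> \<int>"
  shows "x \<in> L"
proof -
  have "coord x $ i1 \<in> \<int>"
    unfolding coord_nth_eq[of x i1] using assms by (intro Ints_minus Ints_sum) auto
  then have "coord x $ i \<in> \<int>" for i using assms(2) by (cases "i = i1") auto
  then show ?thesis using assms(1) by (simp add: L_def)
qed

text \<open>
  The point of \<open>H\<close> with prescribed coordinates except at \<open>i1\<close>, where the coordinate is forced
  by the vanishing of the sum; the value \<open>f i1\<close> is ignored.
\<close>

definition from_coords :: "'d \<Rightarrow> ('d \<Rightarrow> real) \<Rightarrow> real ^ 'd" where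
  "from_coords i1 f = P (\<Sum>i\<in>UNIV-{i1}. f i *\<^sub>R (axis i 1 - axis i1 1))"

lemma from_coords_in_H: "from_coords i1 f \<in> H"
  unfolding from_coords_def by (rule P_in_H)

lemma from_coords_eq: "from_coords i1 f = (\<Sum>i\<in>UNIV-{i1}. f i *\<^sub>R P (axis i 1 - axis i1 1))"
  unfolding from_coords_def by (simp add: linear_sum[OF linear_P] linear_scale[OF linear_P])

lemma sum_axis_diff_nth:
  "i \<noteq> i1 \<Longrightarrow> (\<Sum>j\<in>UNIV-{i1}. f j *\<^sub>R (axis j 1 - axis i1 1)) $ i = (f i :: real)"
  by (simp add: axis_def if_distrib if_distribR sum.delta cong: if_cong)

lemma coord_from_coords: "i \<noteq> i1 \<Longrightarrow> coord (from_coords i1 f) $ i = f i"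
proof -
  assume i: "i \<noteq> i1"
  let ?y = "(\<Sum>i\<in>UNIV-{i1}. f i *\<^sub>R (axis i 1 - axis i1 1)) :: real ^ 'd"
  have "(\<Sum>k\<in>UNIV. ?y $ k) = (\<Sum>i\<in>UNIV-{i1}. \<Sum>k\<in>UNIV. f i * ((axis i 1 :: real^'d) $ k - (axis i1 1 :: real^'d) $ k))"
    by (simp add: sum.swap[of _ "UNIV::'d set"])
  also have "\<dots> = 0"
    by (simp add: axis_def sum_subtractf flip: sum_distrib_left)
  finally have "coord ?y = ?y" by (rule coord_sum_zero)
  then show ?thesis unfolding from_coords_def coord_P using sum_axis_diff_nth[OF i, of f] by simp
qed

lemma from_coords_coord:
  assumes "x \<in> H"
  shows "from_coords i1 (\<lambda>i. coord x $ i) = x"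
proof -
  have "coord (from_coords i1 (\<lambda>i. coord x $ i)) $ i = coord x $ i" for i
  proof (cases "i = i1")
    case True
    have "(\<Sum>i\<in>UNIV-{i1}. coord (from_coords i1 (\<lambda>i. coord x $ i)) $ i) = (\<Sum>i\<in>UNIV-{i1}. coord x $ i)"
      by (intro sum.cong) (auto simp: coord_from_coords)
    then show ?thesis using True by (metis coord_nth_eq)
  qed (simp add: coord_from_coords)
  then have "coord (from_coords i1 (\<lambda>i. coord x $ i)) = coord x" by (simp add: vec_eq_iff)
  then show ?thesis using P_coord[OF assms] P_coord[OF from_coords_in_H] by metis
qed

text \<open>
  A point of \<open>H\<close> is the combination of the generators \<open>P (axis i 1 - axis i1 1)\<close> with its own
  coordinates as coefficients.
\<close>

lemma proj_lattice_eq: "proj_lattice r H i1 = L"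
proof -
  have "proj_lattice r H i1 = range (\<lambda>k :: 'd \<Rightarrow> int. from_coords i1 (\<lambda>i. of_int (k i)))"
    unfolding proj_lattice_def from_coords_eq by auto
  also have "\<dots> = L"
  proof (intro subset_antisym subsetI)
    fix x assume "x \<in> range (\<lambda>k :: 'd \<Rightarrow> int. from_coords i1 (\<lambda>i. of_int (k i)))"
    then show "x \<in> L" by (auto intro!: L_if_other_coords_int[of _ i1] from_coords_in_H simp: coord_from_coords)
  next
    fix x assume x: "x \<in> L"
    then have "coord x $ i = of_int \<lfloor>coord x $ i\<rfloor>" for i by (simp add: L_def)
    then have "x = from_coords i1 (\<lambda>i. of_int \<lfloor>coord x $ i\<rfloor>)"
      using from_coords_coord[OF L_subset[OF x], of i1] by simp
    then show "x \<in> range (\<lambda>k :: 'd \<Rightarrow> int. from_coords i1 (\<lambda>i. of_int (k i)))"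
      by (intro range_eqI[where x="\<lambda>i. \<lfloor>coord x $ i\<rfloor>"]) simp
  qed
  finally show ?thesis .
qed

lemma countable_L: "countable L"
  unfolding proj_lattice_eq[of undefined, symmetric] proj_lattice_def
  by (rule countable_subset[of _ "range (\<lambda>k :: 'd \<Rightarrow> int.
        (\<Sum>i\<in>UNIV - {undefined}. of_int (k i) *\<^sub>R P (axis i 1 - axis undefined 1)))"]) auto

end

sublocale oblique_projection \<subseteq> translation_lattice H L
proof
  show "L \<subseteq> H" using L_subset by blast
  show "0 \<in> L" by (simp add: L_def H_ops coord_def)
qed (auto intro: L_diff countable_L)

context oblique_projection
begin

text \<open>
  The half-open parallelepiped spanned by the generators of the lattice.
\<close>

definition unit_cell :: "'d \<Rightarrow> (real ^ 'd) set" where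
  "unit_cell i1 = {x \<in> H. \<forall>i. i \<noteq> i1 \<longrightarrow> 0 \<le> coord x $ i \<and> coord x $ i < 1}"

lemma norm_le_coord:
  assumes "x \<in> H" "\<And>i. i \<noteq> i1 \<Longrightarrow> \<bar>coord x $ i\<bar> \<le> c"
  shows "norm x \<le> c * (\<Sum>i\<in>UNIV-{i1}. norm (P (axis i 1 - axis i1 1)))"
proof -
  have "norm x = norm (from_coords i1 (\<lambda>i. coord x $ i))" using assms by (simp add: from_coords_coord)
  also have "\<dots> \<le> (\<Sum>i\<in>UNIV-{i1}. \<bar>coord x $ i\<bar> * norm (P (axis i 1 - axis i1 1)))"
    unfolding from_coords_eq by (rule order_trans[OF norm_sum]) simp
  also have "\<dots> \<le> (\<Sum>i\<in>UNIV-{i1}. c * norm (P (axis i 1 - axis i1 1)))"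
    using assms(2) by (intro sum_mono mult_right_mono) auto
  finally show ?thesis by (simp add: sum_distrib_left)
qed

lemma fd_unit_cell: "fd (unit_cell i1)" and bounded_unit_cell: "bounded (unit_cell i1)"
proof -
  have [measurable]: "(\<lambda>x. coord x $ i) \<in> borel_measurable borel" for i
    by (intro borel_measurable_continuous_onI continuous_coord)
  have "unit_cell i1 = H \<inter> {x. \<forall>i. i \<noteq> i1 \<longrightarrow> 0 \<le> coord x $ i \<and> coord x $ i < 1}"
    by (auto simp: unit_cell_def)
  also have "\<dots> \<in> sets (borel_of H)"
    by (simp add: sets_restrict_space_iff) measurable
  finally have sets: "unit_cell i1 \<in> sets (borel_of H)" .
  have "\<exists>!j. j \<in> L \<and> x - j \<in> unit_cell i1" if x: "x \<in> H" for x
  proof (rule ex_ex1I)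
    let ?j = "from_coords i1 (\<lambda>i. of_int \<lfloor>coord x $ i\<rfloor>)"
    have "?j \<in> L" by (rule L_if_other_coords_int[of _ i1]) (simp_all add: from_coords_in_H coord_from_coords)
    moreover have "x - ?j \<in> unit_cell i1"
      using x by (auto simp: unit_cell_def H_ops from_coords_in_H coord_diff coord_from_coords) linarith
    ultimately show "\<exists>j. j \<in> L \<and> x - j \<in> unit_cell i1" by blast
  next
    fix j k assume j: "j \<in> L \<and> x - j \<in> unit_cell i1" and k: "k \<in> L \<and> x - k \<in> unit_cell i1"
    have "coord j $ i = coord k $ i" if "i \<noteq> i1" for i
    proof -
      obtain m n :: int where mn: "coord j $ i = m" "coord k $ i = n"
        using j k by (auto simp: L_def elim!: Ints_cases) (metis Ints_cases)
      with j k that have "0 \<le> coord x $ i - m" "coord x $ i - m < 1"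
        "0 \<le> coord x $ i - n" "coord x $ i - n < 1"
        by (auto simp: unit_cell_def coord_diff)
      then have "real_of_int m < n + 1" "real_of_int n < m + 1" by linarith+
      then have "m = n" by linarith
      then show ?thesis using mn by simp
    qed
    then have "from_coords i1 (\<lambda>i. coord j $ i) = from_coords i1 (\<lambda>i. coord k $ i)"
      unfolding from_coords_def by (intro arg_cong[where f=P] sum.cong) auto
    then show "j = k" using j k by (simp add: from_coords_coord L_subset)
  qed
  with sets show "fd (unit_cell i1)" by (simp add: fundamental_domain_def)
  show "bounded (unit_cell i1)"
    unfolding bounded_iff
  proof (intro exI ballI)
    fix x assume "x \<in> unit_cell i1"
    then show "norm x \<le> 1 * (\<Sum>i\<in>UNIV-{i1}. norm (P (axis i 1 - axis i1 1)))"
      by (intro norm_le_coord) (auto simp: unit_cell_def intro: order.strict_implies_order)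
  qed
qed

section \<open>Periodic functions as functions on a torus\<close>

text \<open>
  The quotient map from \<open>H\<close> to \<open>H\<close> modulo \<open>L\<close>, realized inside a product of unit
  circles.
\<close>

definition torus :: "real ^ 'd \<Rightarrow> complex ^ 'd" where
  "torus x = (\<chi> i. cis (2 * pi * coord x $ i))"

text \<open>
  A Borel right inverse modulo \<open>L\<close> of \<open>torus\<close>: it turns a Borel periodic function on \<open>H\<close>
  into a Borel function of \<open>torus x\<close>.
\<close>

definition section_map :: "'d \<Rightarrow> complex ^ 'd \<Rightarrow> real ^ 'd" where
  "section_map i1 z = from_coords i1 (\<lambda>i. Arg (z $ i) / (2 * pi))"

lemma continuous_torus: "continuous_on S torus"
  unfolding torus_def by (intro continuous_on_vec_lambda continuous_intros continuous_coord)

lemma torus_periodic: "j \<in> L \<Longrightarrow> torus (x + j) = torus x"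
proof -
  assume j: "j \<in> L"
  have "cis (2 * pi * coord (x + j) $ i) = cis (2 * pi * coord x $ i)" for i
  proof -
    have "coord j $ i \<in> \<int>" using j by (simp add: L_def)
    then have "cis (2 * pi * coord j $ i) = 1" using cis_multiple_2pi by simp
    then show ?thesis by (simp add: coord_add ring_distribs flip: cis_mult)
  qed
  then show ?thesis by (simp add: torus_def)
qed

lemma section_torus: "x \<in> H \<Longrightarrow> section_map i1 (torus x) - x \<in> L"
proof (rule L_if_other_coords_int[of _ i1])
  fix i assume "i \<noteq> i1"
  let ?c = "coord x $ i" let ?a = "Arg (cis (2 * pi * ?c))"
  have "cis ?a = cis (2 * pi * ?c)" by (subst cis_Arg) (auto simp: sgn_eq)
  then obtain n :: int where "?a = 2 * pi * ?c + 2 * pi * n"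
    using sin_cos_eq_iff[of ?a "2 * pi * ?c"] by (auto simp: complex_eq_iff)
  then have "?a / (2 * pi) - ?c = of_int n" by (simp add: field_simps)
  then show "coord (section_map i1 (torus x) - x) $ i \<in> \<int>"
    using \<open>i \<noteq> i1\<close> by (simp add: coord_diff section_map_def coord_from_coords torus_def)
qed (simp add: H_ops section_map_def from_coords_in_H)

lemma measurable_section [measurable]: "section_map i1 \<in> measurable borel (borel_of H)"
proof (rule measurable_restrict_space2)
  show "section_map i1 \<in> space borel \<rightarrow> H" by (simp add: section_map_def from_coords_in_H)
  have "(\<lambda>z::complex^'d. z $ i) \<in> borel_measurable borel" for i
    by (intro borel_measurable_continuous_onI continuous_intros)
  from measurable_compose[OF this borel_measurable_Arg]
  show "section_map i1 \<in> borel_measurable borel"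
    unfolding section_map_def from_coords_eq by (intro borel_measurable_sum borel_measurable_scaleR) auto
qed

text \<open>
  The two sides, as functionals of \<open>g\<close>, are integrals against the images on the torus of the
  measures \<open>Leb(F) \<mu>\<close> and \<open>Leb\<close> restricted to \<open>F\<close>. By averaging they agree on continuous functions
  of \<open>torus x\<close>, hence these images coincide, and a Borel periodic \<open>g\<close> is a Borel function of
  \<open>torus x\<close>.
\<close>

lemma nn_integral_eq_average_if_translation_invariant:
  assumes \<mu>: "prob_space \<mu>" and sets_\<mu>: "sets \<mu> = sets (borel_of H)"
    and inv: "\<And>(h :: complex ^ 'd \<Rightarrow> real) t. continuous_on UNIV h \<Longrightarrow> (\<And>z. 0 \<le> h z \<and> h z \<le> 1) \<Longrightarrow>
       t \<in> H \<Longrightarrow> (\<integral>x. h (torus (x + t)) \<partial>\<mu>) = (\<integral>x. h (torus x) \<partial>\<mu>)"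
    and F: "fd F" "emeasure Leb F < \<infinity>"
    and g: "g \<in> borel_measurable (borel_of H)" "periodic g"
  shows "emeasure Leb F * (\<integral>\<^sup>+x. g x \<partial>\<mu>) = (\<integral>\<^sup>+x. indicator F x * g x \<partial>Leb)"
proof -
  interpret \<mu>: prob_space \<mu> by fact
  note [measurable_cong] = sets_\<mu>
  have space_\<mu> [simp]: "space \<mu> = H" using sets_eq_imp_space_eq[OF sets_\<mu>] by simp
  note [measurable] = fd_sets[OF F(1)]
  define i1 :: 'd where "i1 = undefined"
  have torus_meas [measurable]: "torus \<in> borel_measurable (borel_of H)"
    by (intro borel_measurable_continuous_on_restrict continuous_torus)
  define N1 where "N1 = distr (scale_measure (emeasure Leb F) \<mu>) borel torus"
  define N2 where "N2 = distr (density Leb (indicator F)) borel torus"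
  have N1: "(\<integral>\<^sup>+z. f z \<partial>N1) = emeasure Leb F * (\<integral>\<^sup>+x. f (torus x) \<partial>\<mu>)"
    if [measurable]: "f \<in> borel_measurable borel" for f
    unfolding N1_def by (subst nn_integral_distr) (simp_all add: nn_integral_scale_measure)
  have N2: "(\<integral>\<^sup>+z. f z \<partial>N2) = (\<integral>\<^sup>+x. indicator F x * f (torus x) \<partial>Leb)"
    if [measurable]: "f \<in> borel_measurable borel" for f
    unfolding N2_def by (subst nn_integral_distr) (simp_all add: nn_integral_density)
  have "N1 = N2"
  proof (rule finite_borel_measure_eqI_continuous)
    show "sets N1 = sets borel" "sets N2 = sets borel" by (simp_all add: N1_def N2_def)
    have [simp]: "space N1 = UNIV" "space N2 = UNIV" by (simp_all add: N1_def N2_def)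
    show "finite_measure N1"
      using N1[of "\<lambda>_. 1"] F(2) \<mu>.emeasure_space_1 by (intro finite_measureI) auto
    show "finite_measure N2"
      using N2[of "\<lambda>_. 1"] F by (intro finite_measureI) (simp add: fd_sets)
    fix h :: "complex ^ 'd \<Rightarrow> real"
    assume h: "continuous_on UNIV h" "\<And>z. 0 \<le> h z \<and> h z \<le> 1"
    have h_meas [measurable]: "h \<in> borel_measurable borel"
      using h(1) by (rule borel_measurable_continuous_onI)
    have inv_nn: "(\<integral>\<^sup>+x. ennreal (h (torus (x + t))) \<partial>\<mu>) = (\<integral>\<^sup>+x. ennreal (h (torus x)) \<partial>\<mu>)" if t: "t \<in> H" for t
    proof -
      have m1: "(\<lambda>x. h (torus (x + t))) \<in> borel_measurable \<mu>"
        using measurable_compose[OF measurable_translation[OF t] measurable_compose[OF torus_meas h_meas]]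
        by (simp cong: measurable_cong_sets add: sets_\<mu>)
      have m2: "(\<lambda>x. h (torus x)) \<in> borel_measurable \<mu>" by measurable
      have "integrable \<mu> (\<lambda>x. h (torus (x + t)))" "integrable \<mu> (\<lambda>x. h (torus x))"
        using m1 m2 h(2) by (intro \<mu>.integrable_const_bound[where B=1]; auto)+
      then show ?thesis
        using inv[OF h t] h(2) by (simp add: nn_integral_eq_integral)
    qed
    have "(\<integral>\<^sup>+z. ennreal (h z) \<partial>N1) = (\<integral>\<^sup>+z. ennreal (h z) \<partial>N2)"
      unfolding N1[of "\<lambda>z. ennreal (h z)", simplified] N2[of "\<lambda>z. ennreal (h z)", simplified]
    proof (rule nn_integral_average_over_fd[OF \<mu> sets_\<mu> F(1)])
      show "periodic (\<lambda>x. ennreal (h (torus x)))" by (simp add: periodic_def torus_periodic)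
    qed (measurable, rule inv_nn)
    then show "(\<integral>z. h z \<partial>N1) = (\<integral>z. h z \<partial>N2)"
      using h(2) by (subst (1 2) integral_eq_nn_integral) (auto simp: N1_def N2_def)
  qed
  have gs: "g (section_map i1 (torus x)) = g x" if "x \<in> H" for x
    using periodicD[OF g(2) that section_torus[OF that, of i1]] by simp
  have [measurable]: "(\<lambda>z. g (section_map i1 z)) \<in> borel_measurable borel"
    by (rule measurable_compose[OF measurable_section g(1)])
  have "emeasure Leb F * (\<integral>\<^sup>+x. g x \<partial>\<mu>) = emeasure Leb F * (\<integral>\<^sup>+x. g (section_map i1 (torus x)) \<partial>\<mu>)"
    by (intro arg_cong[where f="\<lambda>u. emeasure Leb F * u"] nn_integral_cong) (simp add: gs)
  also have "\<dots> = (\<integral>\<^sup>+x. indicator F x * g (section_map i1 (torus x)) \<partial>Leb)"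
    using N1[of "\<lambda>z. g (section_map i1 z)"] N2[of "\<lambda>z. g (section_map i1 z)"] \<open>N1 = N2\<close> by simp
  also have "\<dots> = (\<integral>\<^sup>+x. indicator F x * g x \<partial>Leb)"
    by (intro nn_integral_cong) (simp add: gs)
  finally show ?thesis .
qed

end

section \<open>Letter frequencies of balanced words\<close>

lemma factor_append: "factor w 0 (m + n) = factor w 0 m @ factor w m n"
  unfolding factor_def by (simp add: upt_add_eq_append[of 0 m n] flip: map_append)

lemma sum_letter_counts:
  fixes w :: "nat \<Rightarrow> 'd::finite"
  shows "(\<Sum>a\<in>UNIV. real (count_list (factor w j n) a)) = real n"
proof -
  have "(\<Sum>a\<in>UNIV. count_list (factor w j n) a) = length (factor w j n)"
    by (rule sum_count_set) auto
  then show ?thesis by (simp add: factor_def flip: of_nat_sum)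
qed

text \<open>
  Cutting a prefix of length \<open>m n\<close> into \<open>m\<close> blocks of length \<open>n\<close>, balance bounds the difference
  between its letter count and \<open>m\<close> times that of the prefix of length \<open>n\<close> by \<open>m C\<close>. Comparing
  the ratios for \<open>m\<close> and \<open>n\<close> through the one for \<open>m n\<close> shows that they form a Cauchy sequence.
\<close>

lemma balanced_letter_freq_tendsto:
  fixes w :: "nat \<Rightarrow> 'd::finite"
  assumes "balanced C w"
  shows "(\<lambda>n. real (count_list (factor w 0 n) a) / real n) \<longlonglongrightarrow> letter_freq w $ a"
proof -
  define f where "f n = real (count_list (factor w 0 n) a)" for n
  have C: "C \<ge> 1" and bal: "\<bar>real (count_list (factor w j n) a) - f n\<bar> \<le> C" for j n
    using assms unfolding balanced_def f_def by auto
  have mult: "\<bar>f (m * n) - real m * f n\<bar> \<le> real m * C" for m n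
  proof (induction m)
    case 0
    show ?case by (simp add: f_def factor_def)
  next
    case (Suc m)
    have "f (Suc m * n) = f (m * n) + real (count_list (factor w (m * n) n) a)"
      using factor_append[of w "m * n" n] by (simp add: f_def add.commute)
    then show ?case using Suc bal[of "m * n" n] by (simp add: algebra_simps)
  qed
  have close: "\<bar>f m / real m - f n / real n\<bar> \<le> C / real m + C / real n" if "m > 0" "n > 0" for m n
  proof -
    have *: "\<bar>f (k * l) / (real k * real l) - f l / real l\<bar> \<le> C / real l" if "k > 0" "l > 0" for k l
    proof -
      have "\<bar>f (k * l) / (real k * real l) - f l / real l\<bar> = \<bar>f (k * l) - real k * f l\<bar> / (real k * real l)"
      proof -
        have "f (k * l) / (real k * real l) - f l / real l = (f (k * l) - real k * f l) / (real k * real l)"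
          using that by (simp add: field_simps)
        then show ?thesis using that by (simp add: abs_mult)
      qed
      also have "\<dots> \<le> (real k * C) / (real k * real l)"
        using mult[of k l] by (intro divide_right_mono) auto
      finally show ?thesis using that by simp
    qed
    from *[OF that] *[OF that(2,1)] show ?thesis
      by (simp add: mult.commute)
  qed
  have "Cauchy (\<lambda>n. f n / real n)"
  proof (rule metric_CauchyI)
    fix e :: real assume e: "e > 0"
    obtain M where M: "real M > 2 * C / e" using reals_Archimedean2 by blast
    then have M0: "real M > 0" using C e by (intro less_trans[OF _ M]) simp
    have small: "C / real n < e / 2" if "n \<ge> M" for n
    proof -
      have "2 * C < real M * e" using M e by (simp add: divide_less_eq)
      also have "\<dots> \<le> real n * e" using that e by simp
      finally show ?thesis using M0 that by (simp add: field_simps)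
    qed
    have "dist (f m / real m) (f n / real n) < e" if "m \<ge> M" "n \<ge> M" for m n
    proof -
      have "m > 0" "n > 0" using M0 that by auto
      then show ?thesis
        unfolding dist_real_def using close[of m n] small[OF that(1)] small[OF that(2)] by linarith
    qed
    then show "\<exists>M. \<forall>m\<ge>M. \<forall>n\<ge>M. dist (f m / real m) (f n / real n) < e" by blast
  qed
  then have "(\<lambda>n. f n / real n) \<longlonglongrightarrow> lim (\<lambda>n. f n / real n)"
    using Cauchy_convergent_iff convergent_LIMSEQ_iff by blast
  then show ?thesis by (simp add: letter_freq_def f_def)
qed

lemma balanced_sum_letter_freq:
  fixes w :: "nat \<Rightarrow> 'd::finite"
  assumes "balanced C w"
  shows "(\<Sum>a\<in>UNIV. letter_freq w $ a) = 1"
proof -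
  have "(\<lambda>n. \<Sum>a\<in>UNIV. real (count_list (factor w 0 n) a) / real n) \<longlonglongrightarrow> (\<Sum>a\<in>UNIV. letter_freq w $ a)"
    by (intro tendsto_sum balanced_letter_freq_tendsto[OF assms])
  moreover have "\<forall>\<^sub>F n in sequentially. (\<Sum>a\<in>UNIV. real (count_list (factor w 0 n) a) / real n) = 1"
    using eventually_gt_at_top[of 0]
    by eventually_elim (simp add: sum_letter_counts flip: sum_divide_distrib)
  ultimately show ?thesis
    by (rule LIMSEQ_unique[OF _ tendsto_eventually])
qed

section \<open>Density of the orbit of a letter step modulo the lattice\<close>

text \<open>
  Integer coefficients suffice, and Kronecker's theorem is stated with them.
\<close>

lemma totally_irrational_intD:
  assumes "totally_irrational r" "(\<Sum>i\<in>UNIV. of_int (c i) * r $ i) = 0"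
  shows "c i = 0"
proof -
  have "(\<Sum>i\<in>UNIV. of_rat (of_int (c i)) * r $ i) = 0" using assms(2) by simp
  then have "\<forall>i. (of_int (c i) :: rat) = 0"
    using assms(1)[unfolded totally_irrational_def, rule_format, of "\<lambda>i. of_int (c i)"] by blast
  then show ?thesis by simp
qed

context oblique_projection
begin

text \<open>
  In coordinates, \<open>P (axis i1 1)\<close> is \<open>-r\<^sub>i\<close> at every \<open>i \<noteq> i1\<close>, so simultaneous inhomogeneous
  approximation of the coordinates of \<open>t\<close> by multiples of these numbers modulo 1 is required.
  Kronecker's theorem provides it once the numbers \<open>r\<^sub>i\<close>, \<open>i \<noteq> i1\<close>, together with 1 are independent
  over the integers. A relation \<open>c + \<Sum>\<^sub>i c\<^sub>i r\<^sub>i = 0\<close> between them becomes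
  \<open>c r\<^bsub>i1\<^esub> + \<Sum>\<^sub>i (c + c\<^sub>i) r\<^sub>i = 0\<close> after substituting \<open>1 = r\<^bsub>i1\<^esub> + \<Sum>\<^sub>i r\<^sub>i\<close>, the sums running
  over \<open>i \<noteq> i1\<close>, so it is trivial by total irrationality.
\<close>

lemma dense_orbit:
  assumes irr: "totally_irrational r" and t: "t \<in> H" and e: "e > 0"
  shows "\<exists>(k::int) j. j \<in> L \<and> dist (of_int k *\<^sub>R P (axis i1 1) + j) t < e"
proof -
  define n where "n = card (UNIV - {i1})"
  obtain b where b: "bij_betw b {..<n} (UNIV - {i1})"
    using ex_bij_betw_nat_finite[of "UNIV - {i1}"] by (auto simp: n_def atLeast0LessThan)
  \<comment> \<open>The letters other than \<open>i1\<close> are numbered below \<open>n\<close>; the constant 1 gets the index \<open>n\<close>.\<close>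
  define \<theta> where "\<theta> k = (if k < n then r $ b k else 1)" for k
  have indep: "c k = 0" if c: "(\<Sum>k\<le>n. of_int (c k) * \<theta> k) = 0" "k \<le> n" for c :: "nat \<Rightarrow> int" and k
  proof -
    \<comment> \<open>The coefficients of the homogeneous relation between the \<open>r\<^sub>i\<close>.\<close>
    define q where "q i = c n + (if i = i1 then 0 else c (the_inv_into {..<n} b i))" for i
    have qb: "q (b k) = c n + c k" if "k < n" for k
      using that b bij_betwE[OF b] by (auto simp: q_def bij_betw_def the_inv_into_f_f)
    have "(\<Sum>i\<in>UNIV. of_int (q i) * r $ i)
        = (\<Sum>i\<in>UNIV. of_int (c n) * r $ i + of_int (q i - c n) * r $ i)"
      by (intro sum.cong) (simp_all add: algebra_simps)
    also have "\<dots> = (\<Sum>i\<in>UNIV. of_int (c n) * r $ i) + (\<Sum>i\<in>UNIV. of_int (q i - c n) * r $ i)"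
      by (rule sum.distrib)
    also have "(\<Sum>i\<in>UNIV. of_int (q i - c n) * r $ i) = (\<Sum>i\<in>UNIV-{i1}. of_int (q i - c n) * r $ i)"
      by (rule sum.mono_neutral_right) (auto simp: q_def)
    also have "(\<Sum>i\<in>UNIV. of_int (c n) * r $ i) = of_int (c n)"
      by (simp add: sum_r flip: sum_distrib_left)
    also have "(\<Sum>i\<in>UNIV-{i1}. of_int (q i - c n) * r $ i) = (\<Sum>k<n. of_int (q (b k) - c n) * r $ b k)"
      by (rule sum.reindex_bij_betw[OF b, symmetric])
    also have "\<dots> = (\<Sum>k<n. of_int (c k) * \<theta> k)"
      by (intro sum.cong) (auto simp: qb \<theta>_def)
    also have "of_int (c n) + \<dots> = (\<Sum>k\<le>n. of_int (c k) * \<theta> k)"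
      by (simp add: lessThan_Suc_atMost[symmetric] \<theta>_def)
    finally have q0: "q i = 0" for i using totally_irrational_intD[OF irr] c by metis
    have "c n = 0" using q0[of i1] by (simp add: q_def)
    then show ?thesis using qb[of k] q0[of "b k"] that(2) by (cases "k = n") auto
  qed
  have inj: "inj_on \<theta> {..n}"
  proof (rule inj_onI, rule ccontr)
    fix k l assume kl: "k \<in> {..n}" "l \<in> {..n}" "\<theta> k = \<theta> l" "k \<noteq> l"
    have "(\<Sum>m\<le>n. of_int ((if m = k then 1 else 0) - (if m = l then 1 else 0)) * \<theta> m)
        = (\<Sum>m\<le>n. (if m = k then \<theta> m else 0) - (if m = l then \<theta> m else 0))"
      by (intro sum.cong) auto
    also have "\<dots> = 0" using kl by (simp add: sum_subtractf)
    finally show False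
      using indep[of "\<lambda>m. (if m = k then 1 else 0) - (if m = l then 1 else 0)" k] kl by simp
  qed
  have module: "module (\<lambda>r x. of_int r * x :: real)"
    by (simp add: Modules.module.intro distrib_left mult.commute)
  have "module.independent (\<lambda>r x. of_int r * x) (\<theta> ` {..n})"
    unfolding module.independent_explicit_module[OF module]
  proof (intro allI impI)
    fix T and u :: "real \<Rightarrow> int" and v
    assume T: "finite T" "T \<subseteq> \<theta> ` {..n}" "(\<Sum>v\<in>T. of_int (u v) * v) = 0" "v \<in> T"
    obtain k where k: "k \<le> n" "v = \<theta> k" using T by auto
    define c where "c k = (if \<theta> k \<in> T then u (\<theta> k) else 0)" for k
    have "(\<Sum>k\<le>n. of_int (c k) * \<theta> k) = (\<Sum>v\<in>\<theta> ` {..n}. of_int (if v \<in> T then u v else 0) * v)"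
      using inj by (simp add: sum.reindex c_def)
    also have "\<dots> = (\<Sum>v\<in>T. of_int (u v) * v)"
      using T(2) by (intro sum.mono_neutral_cong_right) auto
    finally have "c k = 0" using indep[of c] T(3) k(1) by simp
    then show "u v = 0" using k T(4) by (simp add: c_def)
  qed
  moreover have "\<theta> n = 1" by (simp add: \<theta>_def)
  \<comment> \<open>The summand 1 keeps \<open>S\<close> positive when there is only one letter, and makes the final bound strict.\<close>
  moreover define S where "S = 1 + (\<Sum>i\<in>UNIV-{i1}. norm (P (axis i 1 - axis i1 1)))"
  have S: "S \<ge> 1" unfolding S_def by (simp add: sum_nonneg)
  then have "e / S > 0" using e by simp
  ultimately obtain k m where km: "\<And>l. l < n \<Longrightarrow> \<bar>of_int k * \<theta> l - of_int (m l) - (- coord t $ b l)\<bar> < e / S"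
    using Kronecker_thm_2[of \<theta> n "e / S" "\<lambda>l. - coord t $ b l"] inj by metis
  define j where "j = from_coords i1 (\<lambda>i. of_int (m (the_inv_into {..<n} b i)))"
  have j: "j \<in> L" unfolding j_def by (rule L_if_other_coords_int[of _ i1]) (simp_all add: from_coords_in_H coord_from_coords)
  let ?x = "of_int k *\<^sub>R P (axis i1 1) + j - t"
  have "norm ?x \<le> e / S * (\<Sum>i\<in>UNIV-{i1}. norm (P (axis i 1 - axis i1 1)))"
  proof (rule norm_le_coord)
    show "?x \<in> H" by (intro H_ops P_in_H L_subset j t)
    fix i assume i: "i \<noteq> i1"
    then obtain l where l: "l < n" "i = b l" using b by (auto simp: bij_betw_def)
    have "coord (axis i1 1) $ i = - r $ i"
      using i by (simp add: coord_def axis_def)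
    moreover have "coord j $ i = of_int (m l)"
      using i l b by (simp add: j_def coord_from_coords bij_betw_def the_inv_into_f_f)
    ultimately have "coord ?x $ i = - (of_int k * \<theta> l - of_int (m l) - (- coord t $ b l))"
      using l by (simp add: coord_add coord_diff coord_scale coord_P \<theta>_def)
    then show "\<bar>coord ?x $ i\<bar> \<le> e / S" using km[OF l(1)] by simp
  qed
  also have "\<dots> = e / S * (S - 1)" by (simp add: S_def)
  also have "\<dots> < e" using S e by (simp add: field_simps)
  finally show ?thesis using j by (auto simp: dist_norm)
qed

end

section \<open>Prefix measures and their weak limit\<close>

text \<open>
  The normalized prefix measure is the image of the uniform distribution on \<open>{1..n}\<close>. The factor
  \<open>1 / of_nat n\<close> is taken in \<^typ>\<open>ennreal\<close>, where it is infinite at \<open>n = 0\<close>.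
\<close>

lemma integral_prefix_measure:
  fixes f :: "real ^ 'd::finite \<Rightarrow> real"
  assumes f: "f \<in> borel_measurable (borel_of H)" and n: "n > 0"
    and pts: "\<And>i. proj_along r H (abelianization (factor w 0 i)) \<in> H" and H: "H \<in> sets borel"
  shows "(\<integral>x. f x \<partial>scale_measure (1 / of_nat n) (prefix_measure r H w n)) =
    (\<Sum>i=1..n. f (proj_along r H (abelianization (factor w 0 i)))) / real n"
proof -
  define p where "p i = proj_along r H (abelianization (factor w 0 i))" for i
  define Q where "Q = point_measure {1..n} (\<lambda>_. ennreal (1 / real n))"
  have p_meas: "p \<in> measurable Q (borel_of H)"
    unfolding Q_def point_measure_def using pts H by (auto simp: p_def space_restrict_space2)
  have "scale_measure (1 / of_nat n) (prefix_measure r H w n) = distr Q (borel_of H) p"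
  proof (rule measure_eqI)
    have sets: "sets (prefix_measure r H w n) = sets (borel_of H)"
      unfolding prefix_measure_def by (rule sets_sum_measure) auto
    then show "sets (scale_measure (1 / of_nat n) (prefix_measure r H w n)) = sets (distr Q (borel_of H) p)"
      by simp
    fix A assume "A \<in> sets (scale_measure (1 / of_nat n) (prefix_measure r H w n))"
    then have A: "A \<in> sets (borel_of H)" by (simp add: sets)
    have "emeasure (prefix_measure r H w n) A = (\<Sum>i\<in>{1..n}. indicator A (p i))"
      unfolding prefix_measure_def p_def[symmetric] using A
      by (subst emeasure_sum_measure) (auto simp: nn_integral_count_space_finite)
    moreover have "emeasure (distr Q (borel_of H) p) A = (\<Sum>i\<in>{1..n}. ennreal (1 / real n) * indicator A (p i))"
    proof -
      have "emeasure (distr Q (borel_of H) p) A = emeasure Q (p -` A \<inter> {1..n})"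
        using emeasure_distr[OF p_meas A] by (simp add: Q_def space_point_measure)
      also have "\<dots> = (\<Sum>i\<in>p -` A \<inter> {1..n}. ennreal (1 / real n))"
        unfolding Q_def by (rule emeasure_point_measure_finite) auto
      also have "\<dots> = (\<Sum>i\<in>{1..n}. ennreal (1 / real n) * indicator A (p i))"
        by (rule sum.mono_neutral_cong_left) (auto simp: indicator_def)
      finally show ?thesis .
    qed
    moreover have "(1 / of_nat n :: ennreal) = ennreal (1 / real n)"
      using n by (simp add: divide_ennreal ennreal_of_nat_eq_real_of_nat flip: ennreal_1)
    ultimately show "emeasure (scale_measure (1 / of_nat n) (prefix_measure r H w n)) A
        = emeasure (distr Q (borel_of H) p) A"
      by (simp add: sum_distrib_left)
  qed
  then have "(\<integral>x. f x \<partial>scale_measure (1 / of_nat n) (prefix_measure r H w n)) = (\<integral>i. f (p i) \<partial>Q)"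
    using integral_distr[OF p_meas f] by simp
  also have "\<dots> = (\<Sum>i=1..n. (1 / real n) *\<^sub>R f (p i))"
    unfolding Q_def by (rule lebesgue_integral_point_measure_finite) auto
  finally show ?thesis by (simp add: p_def sum_divide_distrib)
qed

context oblique_projection
begin

text \<open>
  The difference between the steps of the letters \<open>w n\<close> and \<open>i1\<close> is an element of the lattice.
\<close>

lemma prefix_point_step:
  fixes w :: "nat \<Rightarrow> 'd"
  shows "\<exists>j\<in>L. P (abelianization (factor w 0 (Suc n))) = P (abelianization (factor w 0 n)) + P (axis i1 1) + j"
proof -
  define j where "j = P (axis (w n) 1 - axis i1 1)"
  have "(\<Sum>i\<in>UNIV. (axis (w n) 1 - axis i1 1 :: real ^ 'd) $ i) = 0"
    by (simp add: axis_def sum_subtractf)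
  then have "coord j = axis (w n) 1 - axis i1 1"
    unfolding j_def coord_P by (rule coord_sum_zero)
  then have "j \<in> L" by (simp add: L_def j_def P_in_H axis_def)
  have "abelianization (factor w 0 (Suc n)) = abelianization (factor w 0 n) + axis (w n) 1"
    by (simp add: abelianization_def factor_def vec_eq_iff axis_def)
  then have "P (abelianization (factor w 0 (Suc n))) = P (abelianization (factor w 0 n)) + P (axis i1 1) + j"
    by (simp add: j_def linear_add[OF linear_P] linear_diff[OF linear_P])
  then show ?thesis using \<open>j \<in> L\<close> by blast
qed

text \<open>
  For periodic \<open>h\<close>, translating the first \<open>n\<close> projected prefixes by \<open>P (axis i1 1)\<close> has the
  effect of passing to prefixes \<open>2, \<dots>, n + 1\<close>. The two averages differ by
  \<open>(h(p\<^sub>n\<^sub>+\<^sub>1) - h(p\<^sub>1)) / n\<close>, which tends to 0 as \<open>h\<close> is bounded.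
\<close>

lemma weak_limit_shift:
  fixes w :: "nat \<Rightarrow> 'd" and h :: "real ^ 'd \<Rightarrow> real"
  assumes lim: "weak_limit_on H (\<lambda>n. scale_measure (1 / of_nat n) (prefix_measure r H w n)) \<mu>"
    and h: "continuous_on H h" "bounded (h ` H)" "periodic h"
  shows "(\<integral>x. h (x + P (axis i1 1)) \<partial>\<mu>) = (\<integral>x. h x \<partial>\<mu>)"
proof -
  define p where "p i = P (abelianization (factor w 0 i))" for i
  let ?a = "P (axis i1 1)"
  have pH: "p i \<in> H" for i by (simp add: p_def P_in_H)
  have avg: "(\<lambda>n. (\<Sum>i=1..n. f (p i)) / real n) \<longlonglongrightarrow> (\<integral>x. f x \<partial>\<mu>)"
    if f: "continuous_on H f" "bounded (f ` H)" for f :: "real ^ 'd \<Rightarrow> real"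
  proof -
    have "(\<lambda>n. \<integral>x. f x \<partial>scale_measure (1 / of_nat n) (prefix_measure r H w n)) \<longlonglongrightarrow> (\<integral>x. f x \<partial>\<mu>)"
      using lim f unfolding weak_limit_on_def by blast
    moreover have "\<forall>\<^sub>F n in sequentially. (\<integral>x. f x \<partial>scale_measure (1 / of_nat n) (prefix_measure r H w n))
        = (\<Sum>i=1..n. f (p i)) / real n"
      using eventually_gt_at_top[of 0]
    proof eventually_elim
      case (elim n)
      show ?case
        unfolding p_def using elim f(1) P_in_H
        by (intro integral_prefix_measure borel_measurable_continuous_on_restrict) auto
    qed
    ultimately show ?thesis by (rule Lim_transform_eventually)
  qed
  have "continuous_on H (\<lambda>x. h (x + ?a))"
    by (rule continuous_on_compose2[OF h(1)]) (auto intro!: continuous_intros H_ops P_in_H)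
  moreover have "bounded ((\<lambda>x. h (x + ?a)) ` H)"
    by (rule bounded_subset[OF h(2)]) (auto intro: H_ops P_in_H)
  ultimately have "(\<lambda>n. (\<Sum>i=1..n. h (p i + ?a)) / real n) \<longlonglongrightarrow> (\<integral>x. h (x + ?a) \<partial>\<mu>)"
    by (rule avg)
  moreover have "h (p i + ?a) = h (p (Suc i))" for i
  proof -
    obtain j where "j \<in> L" "p (Suc i) = p i + ?a + j"
      using prefix_point_step unfolding p_def by blast
    then show ?thesis using periodicD[OF h(3), of "p i + ?a" j] by (simp add: H_ops pH P_in_H)
  qed
  ultimately have "(\<lambda>n. (\<Sum>i=1..n. h (p (Suc i))) / real n) \<longlonglongrightarrow> (\<integral>x. h (x + ?a) \<partial>\<mu>)"
    by simp
  from tendsto_diff[OF this avg[OF h(1,2)]]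
  have diff: "(\<lambda>n. (\<Sum>i=1..n. h (p (Suc i)) - h (p i)) / real n) \<longlonglongrightarrow>
      (\<integral>x. h (x + ?a) \<partial>\<mu>) - (\<integral>x. h x \<partial>\<mu>)"
    by (simp add: sum_subtractf diff_divide_distrib)
  have telescope: "(\<Sum>i=1..n. h (p (Suc i)) - h (p i)) = h (p (Suc n)) - h (p 1)" for n
    using sum_Suc_diff[of 1 n "\<lambda>i. h (p i)"] by simp
  have "(\<lambda>n. (h (p (Suc n)) - h (p 1)) / real n) \<longlonglongrightarrow> 0"
  proof -
    obtain B where B: "\<And>x. x \<in> H \<Longrightarrow> \<bar>h x\<bar> \<le> B"
      using h(2) unfolding bounded_iff by auto
    have "\<bar>h (p (Suc n)) - h (p 1)\<bar> \<le> 2 * B" for n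
      using B[OF pH, of "Suc n"] B[OF pH, of 1] by linarith
    then have "norm ((h (p (Suc n)) - h (p 1)) / real n) \<le> 2 * B / real n" for n
      by (simp add: divide_right_mono)
    then show ?thesis
      by (intro Lim_null_comparison[OF always_eventually lim_const_over_n]) blast
  qed
  with diff[unfolded telescope] have "(\<integral>x. h (x + ?a) \<partial>\<mu>) - (\<integral>x. h x \<partial>\<mu>) = 0"
    by (rule LIMSEQ_unique)
  then show ?thesis by simp
qed

text \<open>
  Weak convergence is tested against all bounded continuous functions, among them the constant 1, so
  no mass escapes.
\<close>

lemma weak_limit_prob_space:
  fixes w :: "nat \<Rightarrow> 'd"
  assumes lim: "weak_limit_on H (\<lambda>n. scale_measure (1 / of_nat n) (prefix_measure r H w n)) \<mu>"
  shows "prob_space \<mu>"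
proof -
  interpret finite_measure \<mu> using lim by (simp add: weak_limit_on_def)
  have "(\<lambda>n. \<integral>x. (1::real) \<partial>scale_measure (1 / of_nat n) (prefix_measure r H w n)) \<longlonglongrightarrow> (\<integral>x. 1 \<partial>\<mu>)"
  proof -
    have "continuous_on H (\<lambda>x. 1::real) \<and> bounded ((\<lambda>x. 1::real) ` H)"
      by (auto simp: bounded_iff intro!: exI[of _ 1])
    then show ?thesis using lim unfolding weak_limit_on_def by blast
  qed
  moreover have "\<forall>\<^sub>F n in sequentially. (\<integral>x. (1::real) \<partial>scale_measure (1 / of_nat n) (prefix_measure r H w n)) = 1"
    using eventually_gt_at_top[of 0]
  proof eventually_elim
    case (elim n)
    then show ?case using integral_prefix_measure[of "\<lambda>_. 1" H n r w] P_in_H by simp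
  qed
  ultimately have "(\<integral>x. (1::real) \<partial>\<mu>) = 1"
    by (rule LIMSEQ_unique[OF _ tendsto_eventually])
  then have "emeasure \<mu> (space \<mu>) = 1" by (simp add: emeasure_eq_measure)
  then show ?thesis by (rule prob_spaceI)
qed

end

section \<open>The periodized limit measure\<close>

theorem theorem3p12:
  fixes w :: "nat \<Rightarrow> 'd::finite" and C :: real
    and r :: "real ^ 'd" and H :: "(real ^ 'd) set" and i1 :: 'd
    and J :: "(real ^ 'd) set" and \<mu> :: "(real ^ 'd) measure"
  assumes "balanced C w"
    and "r = letter_freq w"
    and "totally_irrational r"
    and "subspace H" and "dim H = CARD('d) - 1" and "r \<notin> H"
    and "J = proj_lattice r H i1"
    and "weak_limit_on H (\<lambda>n. scale_measure (1 / of_nat n) (prefix_measure r H w n)) \<mu>"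
  shows "sum_measure (borel_of H) J (\<lambda>j. distr \<mu> (borel_of H) (\<lambda>x. x + j)) =
         scale_measure (lattice_density H J) (subspace_lborel H)"
proof -
  interpret oblique_projection H r
    using assms balanced_sum_letter_freq by unfold_locales auto
  have J: "J = L" using assms proj_lattice_eq by simp
  have \<mu>: "prob_space \<mu>" "sets \<mu> = sets (borel_of H)"
    using weak_limit_prob_space assms unfolding weak_limit_on_def by auto
  have inv: "(\<integral>x. h (torus (x + t)) \<partial>\<mu>) = (\<integral>x. h (torus x) \<partial>\<mu>)"
    if h: "continuous_on UNIV h" "\<And>z. 0 \<le> h z \<and> h z \<le> 1" and t: "t \<in> H"
    for h :: "complex ^ 'd \<Rightarrow> real" and t
  proof (rule translation_invariance_from_dense_multiples[OF \<mu> P_in_H])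
    show "continuous_on H (\<lambda>x. h (torus x))"
      by (rule continuous_on_compose2[OF h(1) continuous_torus]) simp
    show "bounded ((\<lambda>x. h (torus x)) ` H)"
      using h(2) by (auto simp: bounded_iff intro!: exI[of _ 1])
    show "periodic (\<lambda>x. h (torus x))" by (simp add: periodic_def torus_periodic)
  qed (use weak_limit_shift[OF assms(8)] dense_orbit[OF assms(3)] t in blast)+
  define F where "F = (SOME F. fd F)"
  have F: "fd F" unfolding F_def using fd_unit_cell by (rule someI)
  have F_fin: "emeasure Leb F < \<infinity>" by (rule emeasure_fd_finite[OF F fd_unit_cell bounded_unit_cell])
  have density: "lattice_density H L = 1 / emeasure Leb F"
    by (simp add: lattice_density_def F_def)
  show ?thesis
    unfolding J density
    by (rule periodization_measure_eq[OF \<mu>(2) F F_fin])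
      (rule nn_integral_eq_average_if_translation_invariant[OF \<mu> inv F F_fin])
qed

end
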